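(* Let $n\ge 1$, let $W\in C^2(\mathbb{R}^n;\mathbb{R})$, and for $u:\mathbb{R}^n\to\mathbb{R}^n$ let $T=T(u,\nabla u)$ be the stress-energy tensor defined in the context. (i) If $u\in W^{1,2}_{\mathrm{loc}}(\mathbb{R}^n;\mathbb{R}^n)\cap L^\infty_{\mathrm{loc}}(\mathbb{R}^n;\mathbb{R}^n)$ is a solution of $\Delta u-W_u(u)=0$ in $\mathbb{R}^n$, then $\operatorname{div}T=0$ in $\mathbb{R}^n$. (ii) If $u:\mathbb{R}^n\to\mathbb{R}^n$ is smooth, $\operatorname{div}T=0$ in $\mathbb{R}^n$, and $\det\nabla u\neq 0$ in $\mathbb{R}^n$, then $\Delta u-W_u(u)=0$ in $\mathbb{R}^n$.
   Context: $W_u=(\partial W/\partial u_1,\dots,\partial W/\partial u_n)^\top$ is the gradient of $W$; $\nabla u$ is the $n\times n$ matrix $(\partial u_i/\partial x_j)$; $u_{x_i}=\partial u/\partial x_i\in\mathbb{R}^n$; $\cdot$ and $|\cdot|$ are the Euclidean inner product and norm. The stress-energy tensor $T$ is the symmetric $n\times n$ matrix with entries $$T_{ij}=u_{x_i}\cdot u_{x_j}\quad (i\ne j),\qquad T_{ii}=\frac12\Big(|u_{x_i}|^2-\sum_{k\neq i}|u_{x_k}|^2-2W(u)\Big).$$ Its divergence is taken row by row: $\operatorname{div}T$ is the vector with $i$-th component $\sum_{j=1}^n \partial T_{ij}/\partial x_j$. Solutions in $W^{1,2}_{\mathrm{loc}}\cap L^\infty_{\mathrm{loc}}$ are understood in the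 weak (distributional) sense. *)

theory Defs
  imports "HOL-Analysis.Analysis"
begin

section \<open>Classical calculus\<close>

text \<open>Only ever applied to functions that are (Frechet) differentiable, where the directional
  derivative along the \<open>j\<close>-th unit vector is the \<open>j\<close>-th partial derivative.\<close>

definition partial_deriv ::
    "'n::finite \<Rightarrow> (real^'n \<Rightarrow> 'b::real_normed_vector) \<Rightarrow> real^'n \<Rightarrow> 'b" where
  "partial_deriv j f x = frechet_derivative f (at x) (axis j 1)"

primrec C_k :: "nat \<Rightarrow> (real^'n::finite \<Rightarrow> 'b::real_normed_vector) \<Rightarrow> bool" where
  "C_k 0 f \<longleftrightarrow> continuous_on UNIV f"
| "C_k (Suc k) f \<longleftrightarrow> (\<forall>x. f differentiable (at x)) \<and> (\<forall>j. C_k k (partial_deriv j f))"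

definition smooth :: "(real^'n::finite \<Rightarrow> 'b::real_normed_vector) \<Rightarrow> bool" where
  "smooth f \<longleftrightarrow> (\<forall>k. C_k k f)"

definition gradient :: "(real^'n::finite \<Rightarrow> real) \<Rightarrow> real^'n \<Rightarrow> real^'n" where
  "gradient W p = (\<chi> i. partial_deriv i W p)"

definition laplacian ::
    "(real^'n::finite \<Rightarrow> 'b::real_normed_vector) \<Rightarrow> real^'n \<Rightarrow> 'b" where
  "laplacian u x = (\<Sum>j\<in>UNIV. partial_deriv j (partial_deriv j u) x)"

definition row_div :: "(real^'n::finite \<Rightarrow> real^'n^'n) \<Rightarrow> real^'n \<Rightarrow> real^'n" where
  "row_div S x = (\<chi> i. \<Sum>j\<in>UNIV. partial_deriv j (\<lambda>y. S y $ i $ j) x)"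


section \<open>The stress-energy tensor\<close>

text \<open>The tensor as a function of the value \<open>p = u(x)\<close> and of the matrix \<open>G = \<nabla>u(x)\<close>, with
  \<open>G $ i $ j = \<partial>u\<^sub>i/\<partial>x\<^sub>j\<close> as in \<^const>\<open>jacobian\<close>; thus the partial derivative of \<open>u\<close> with respect
  to \<open>x\<^sub>i\<close> is \<open>column i G\<close>.\<close>

definition stress_energy :: "(real^'n::finite \<Rightarrow> real) \<Rightarrow> real^'n \<Rightarrow> real^'n^'n \<Rightarrow> real^'n^'n" where
  "stress_energy W p G = (\<chi> i j.
     if i = j
     then 1/2 * ((norm (column i G))\<^sup>2 - (\<Sum>k\<in>UNIV - {i}. (norm (column k G))\<^sup>2) - 2 * W p)
     else column i G \<bullet> column j G)"


section \<open>Local Lebesgue and Sobolev spaces, weak derivatives\<close>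

definition test_function :: "(real^'n::finite \<Rightarrow> real) \<Rightarrow> bool" where
  "test_function \<phi> \<longleftrightarrow> smooth \<phi> \<and> compact (closure {x. \<phi> x \<noteq> 0})"

definition L1_loc :: "(real^'n::finite \<Rightarrow> 'b::euclidean_space) \<Rightarrow> bool" where
  "L1_loc f \<longleftrightarrow> f \<in> borel_measurable lebesgue \<and>
     (\<forall>K. compact K \<longrightarrow> set_integrable lebesgue K (\<lambda>x. norm (f x)))"

definition L2_loc :: "(real^'n::finite \<Rightarrow> 'b::euclidean_space) \<Rightarrow> bool" where
  "L2_loc f \<longleftrightarrow> f \<in> borel_measurable lebesgue \<and>
     (\<forall>K. compact K \<longrightarrow> set_integrable lebesgue K (\<lambda>x. (norm (f x))\<^sup>2))"

definition Linf_loc :: "(real^'n::finite \<Rightarrow> 'b::euclidean_space) \<Rightarrow> bool" where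
  "Linf_loc f \<longleftrightarrow> f \<in> borel_measurable lebesgue \<and>
     (\<forall>K. compact K \<longrightarrow> (\<exists>C. AE x in lebesgue. x \<in> K \<longrightarrow> norm (f x) \<le> C))"

definition weak_gradient ::
    "(real^'n::finite \<Rightarrow> real^'n) \<Rightarrow> (real^'n \<Rightarrow> real^'n^'n) \<Rightarrow> bool" where
  "weak_gradient u Du \<longleftrightarrow> L1_loc u \<and> L1_loc Du \<and>
     (\<forall>\<phi> i j. test_function \<phi> \<longrightarrow>
        (LINT x|lebesgue. u x $ i * partial_deriv j \<phi> x) = - (LINT x|lebesgue. Du x $ i $ j * \<phi> x))"

text \<open>\<open>u\<close> belongs to \<open>W\<^sup>1\<^sup>,\<^sup>2\<close> locally, and \<open>Du\<close> represents its (almost everywhere unique)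
  weak gradient.\<close>

definition W12_loc ::
    "(real^'n::finite \<Rightarrow> real^'n) \<Rightarrow> (real^'n \<Rightarrow> real^'n^'n) \<Rightarrow> bool" where
  "W12_loc u Du \<longleftrightarrow> L2_loc u \<and> L2_loc Du \<and> weak_gradient u Du"

text \<open>\<open>div S = F\<close> in the sense of distributions, the divergence being taken row by row.\<close>

definition weak_row_div ::
    "(real^'n::finite \<Rightarrow> real^'n^'n) \<Rightarrow> (real^'n \<Rightarrow> real^'n) \<Rightarrow> bool" where
  "weak_row_div S F \<longleftrightarrow> L1_loc S \<and> L1_loc F \<and>
     (\<forall>\<phi> i. test_function \<phi> \<longrightarrow>
        (LINT x|lebesgue. (\<Sum>j\<in>UNIV. S x $ i $ j * partial_deriv j \<phi> x))
          = - (LINT x|lebesgue. F x $ i * \<phi> x))"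

text \<open>Weak form of \<open>\<Delta>u - W\<^sub>u(u) = 0\<close>, with \<open>\<Delta>u = div \<nabla>u\<close>. The integrability of \<open>W\<^sub>u(u)\<close> required
  in \<^const>\<open>weak_row_div\<close> is automatic for locally bounded \<open>u\<close> and continuous \<open>W\<^sub>u\<close>.\<close>

definition weak_solution ::
    "(real^'n::finite \<Rightarrow> real) \<Rightarrow> (real^'n \<Rightarrow> real^'n) \<Rightarrow> (real^'n \<Rightarrow> real^'n^'n) \<Rightarrow> bool" where
  "weak_solution W u Du \<longleftrightarrow> weak_row_div Du (\<lambda>x. gradient W (u x))"

end

theory Submission
  imports Defs
begin

text \<open>
  For a function \<open>v\<close> of class \<open>C\<^sup>2\<close> with gradient \<open>P = \<nabla>v\<close> one has
  \<open>div T(v, P) = P\<^sup>T (\<Delta>v - W\<^sub>u(v))\<close>. This gives (ii), because \<open>P\<^sup>T\<close> is invertible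
  when \<open>det P \<noteq> 0\<close>.

  For (i) no regularity theory is needed. The mollification \<open>v = u * \<rho>\<close> of a weak solution is smooth,
  with \<open>\<nabla>v = Du * \<rho>\<close> and \<open>\<Delta>v = W\<^sub>u(u) * \<rho>\<close>, so for a test function \<open>\<phi>\<close> the identity reads
  \<open>\<integral> \<Sum>\<^sub>j T\<^sub>i\<^sub>j(v, P) \<partial>\<^sub>j\<phi> = - \<integral> (P\<^sup>T (W\<^sub>u(u) * \<rho> - W\<^sub>u(v)))\<^sub>i \<phi>\<close>. As \<open>\<rho>\<close> concentrates,
  \<open>v\<close>, \<open>P\<close> and \<open>W\<^sub>u(u) * \<rho>\<close> converge in \<open>L\<^sup>2\<close> on the support of \<open>\<phi>\<close>, hence so do \<open>W(v)\<close> and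
  \<open>W\<^sub>u(v)\<close> because \<open>u\<close> is locally bounded and \<open>W\<close>, \<open>W\<^sub>u\<close> are locally Lipschitz. All terms are products
  of two such factors, so both sides converge, the right one to 0.
\<close>

section \<open>Directional partial derivatives\<close>

text \<open>For \<open>u\<close> in W^(1,2) only, \<open>Du\<close> has no derivative to which a
  product rule could apply, so the identity has to be reached through smooth functions.
  Mollification does not commute with the nonlinearity; what is left over is the commutator of W_u
  with averaging, and local boundedness of \<open>u\<close> is what makes it small. The tensor is
  quadratic in the gradient, so L2 convergence of gradients gives L1 convergence of tensors, exactly
  what a bounded factor from the test function can absorb. The algebra must serve a Jacobian in (ii)
  and convolutions in (i). It is therefore proved for a matrix field together with an array of its
  partial derivatives, and the cancellation rests on the symmetry of that array. Partial derivatives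
  are derivatives along lines, a relation without default values; a convolution obtains them from a
  dominated difference quotient. Fubini is applied to Borel functions, while the hypotheses speak of
  Lebesgue measurable ones; the change to Borel representatives is made componentwise at the
  end.\<close>

definition has_pderiv :: "'n::finite \<Rightarrow> (real^'n \<Rightarrow> real) \<Rightarrow> real \<Rightarrow> real^'n \<Rightarrow> bool" where
  "has_pderiv j f d x \<longleftrightarrow> ((\<lambda>t. f (x + t *\<^sub>R axis j 1)) has_real_derivative d) (at 0)"

lemma has_pderiv_line:
  assumes "\<And>y. has_pderiv j f (f' y) y"
  shows "((\<lambda>t. f (x + t *\<^sub>R axis j 1)) has_real_derivative f' (x + s *\<^sub>R axis j 1)) (at s)"
proof -
  have "((\<lambda>t. f (x + s *\<^sub>R axis j 1 + t *\<^sub>R axis j 1)) has_real_derivative f' (x + s *\<^sub>R axis j 1)) (at 0)"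
    using assms unfolding has_pderiv_def by blast
  then show ?thesis
    using DERIV_shift[of "\<lambda>t. f (x + t *\<^sub>R axis j 1)" "f' (x + s *\<^sub>R axis j 1)" 0 s]
    by (simp add: algebra_simps scaleR_add_left)
qed

lemma has_pderiv_unique: "has_pderiv j f d x \<Longrightarrow> has_pderiv j f d' x \<Longrightarrow> d = d'"
  unfolding has_pderiv_def by (rule DERIV_unique)

lemma has_pderiv_const: "has_pderiv j (\<lambda>x. c) 0 x"
  unfolding has_pderiv_def by simp

lemma has_pderiv_add:
  "has_pderiv j f d x \<Longrightarrow> has_pderiv j g e x \<Longrightarrow> has_pderiv j (\<lambda>x. f x + g x) (d + e) x"
  unfolding has_pderiv_def by (rule DERIV_add)

lemma has_pderiv_diff:
  "has_pderiv j f d x \<Longrightarrow> has_pderiv j g e x \<Longrightarrow> has_pderiv j (\<lambda>x. f x - g x) (d - e) x"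
  unfolding has_pderiv_def by (rule DERIV_diff)

lemma has_pderiv_cmult:
  "has_pderiv j f d x \<Longrightarrow> has_pderiv j (\<lambda>x. c * f x) (c * d) x"
  unfolding has_pderiv_def by (rule DERIV_cmult)

lemma has_pderiv_mult:
  "has_pderiv j f d x \<Longrightarrow> has_pderiv j g e x \<Longrightarrow> has_pderiv j (\<lambda>x. f x * g x) (d * g x + e * f x) x"
  unfolding has_pderiv_def by (drule (1) DERIV_mult) simp

lemma has_pderiv_sum:
  "(\<And>i. i \<in> I \<Longrightarrow> has_pderiv j (f i) (d i) x) \<Longrightarrow> has_pderiv j (\<lambda>x. \<Sum>i\<in>I. f i x) (\<Sum>i\<in>I. d i) x"
  unfolding has_pderiv_def by (rule DERIV_sum)

lemma has_derivative_imp_has_pderiv: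
  assumes "(f has_derivative f') (at x)"
  shows "has_pderiv j f (f' (axis j 1)) x"
proof -
  have "((\<lambda>t::real. x + t *\<^sub>R axis j 1) has_derivative (\<lambda>t. t *\<^sub>R axis j 1)) (at 0)"
    by (auto intro!: derivative_eq_intros)
  then have "((\<lambda>t. f (x + t *\<^sub>R axis j 1)) has_derivative (\<lambda>t. f' (t *\<^sub>R axis j 1))) (at 0)"
    using has_derivative_compose[of "\<lambda>t::real. x + t *\<^sub>R axis j 1" _ 0 UNIV f f'] assms by simp
  moreover have "(\<lambda>t. f' (t *\<^sub>R axis j 1)) = (*) (f' (axis j 1))"
    using linear_scale[OF has_derivative_linear[OF assms]] by (auto simp: mult.commute)
  ultimately show ?thesis
    unfolding has_pderiv_def has_field_derivative_def by simp
qed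

lemma differentiable_imp_has_pderiv:
  "f differentiable (at x) \<Longrightarrow> has_pderiv j f (partial_deriv j f x) x"
  unfolding partial_deriv_def
  by (intro has_derivative_imp_has_pderiv) (simp add: frechet_derivative_works)

lemma differentiable_vec_nth:
  "(f :: real^'n::finite \<Rightarrow> real^'m::finite) differentiable (at x) \<Longrightarrow> (\<lambda>y. f y $ i) differentiable (at x)"
  unfolding differentiable_def by (blast intro: bounded_linear.has_derivative[OF bounded_linear_vec_nth])

lemma partial_deriv_vec_nth:
  assumes "(f :: real^'n::finite \<Rightarrow> real^'m::finite) differentiable (at x)"
  shows "partial_deriv j (\<lambda>y. f y $ i) x = partial_deriv j f x $ i"
proof -
  have "(f has_derivative frechet_derivative f (at x)) (at x)"
    using assms frechet_derivative_works by blast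
  then have "((\<lambda>y. f y $ i) has_derivative (\<lambda>h. frechet_derivative f (at x) h $ i)) (at x)"
    by (rule bounded_linear.has_derivative[OF bounded_linear_vec_nth])
  from fun_cong[OF frechet_derivative_at[OF this], of "axis j 1"] show ?thesis
    unfolding partial_deriv_def by simp
qed

section \<open>Mean values along coordinate lines and symmetry of mixed partial derivatives\<close>

lemma mean_value_pderiv:
  assumes "\<And>y. has_pderiv j f (f' y) y"
  shows "\<exists>s. \<bar>s\<bar> \<le> \<bar>h\<bar> \<and> f (x + h *\<^sub>R axis j 1) - f x = h * f' (x + s *\<^sub>R axis j 1)"
proof -
  let ?F = "\<lambda>t. f (x + t *\<^sub>R axis j 1)" and ?F' = "\<lambda>t. f' (x + t *\<^sub>R axis j 1)"
  have d: "(?F has_real_derivative ?F' t) (at t)" for t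
    using assms by (rule has_pderiv_line)
  consider "h = 0" | "h > 0" | "h < 0" by linarith
  then show ?thesis
  proof cases
    case 1 then show ?thesis by (intro exI[of _ 0]) simp
  next
    case 2
    from MVT2[OF this, of ?F ?F'] d obtain z where "0 < z" "z < h" "?F h - ?F 0 = (h - 0) * ?F' z"
      by auto
    then show ?thesis by (intro exI[of _ z]) simp
  next
    case 3
    from MVT2[OF this, of ?F ?F'] d obtain z where "h < z" "z < 0" "?F 0 - ?F h = (0 - h) * ?F' z"
      by auto
    then show ?thesis by (intro exI[of _ z]) (simp add: algebra_simps)
  qed
qed

text \<open>The mean value theorem is used twice: in direction \<open>i\<close> for the increment
  \<open>f (y + h *\<^sub>R axis j 1) - f y\<close>, then in direction \<open>j\<close> for
  \<open>fi\<close>. The second difference on the left is symmetric in \<open>i\<close> and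
  \<open>j\<close>, so it can be evaluated in either order.\<close>

lemma mixed_difference_quotient:
  assumes fi: "\<And>y. has_pderiv i f (fi y) y" and fij: "\<And>y. has_pderiv j fi (fij y) y"
  shows "\<exists>s t. \<bar>s\<bar> \<le> \<bar>h\<bar> \<and> \<bar>t\<bar> \<le> \<bar>h\<bar> \<and>
    f (x + h *\<^sub>R axis i 1 + h *\<^sub>R axis j 1) - f (x + h *\<^sub>R axis i 1) - f (x + h *\<^sub>R axis j 1) + f x
      = h * h * fij (x + s *\<^sub>R axis i 1 + t *\<^sub>R axis j 1)"
proof -
  have "has_pderiv i (\<lambda>y. f (y + h *\<^sub>R axis j 1) - f y) (fi (y + h *\<^sub>R axis j 1) - fi y) y" for y
    using fi[of "y + h *\<^sub>R axis j 1"] fi[of y]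
    unfolding has_pderiv_def by (auto intro!: derivative_eq_intros simp: algebra_simps)
  from mean_value_pderiv[OF this, of h x] obtain s where s: "\<bar>s\<bar> \<le> \<bar>h\<bar>"
    "f (x + h *\<^sub>R axis i 1 + h *\<^sub>R axis j 1) - f (x + h *\<^sub>R axis i 1) - (f (x + h *\<^sub>R axis j 1) - f x)
      = h * (fi (x + s *\<^sub>R axis i 1 + h *\<^sub>R axis j 1) - fi (x + s *\<^sub>R axis i 1))"
    by blast
  from mean_value_pderiv[OF fij, of h "x + s *\<^sub>R axis i 1"] obtain t where "\<bar>t\<bar> \<le> \<bar>h\<bar>"
    "fi (x + s *\<^sub>R axis i 1 + h *\<^sub>R axis j 1) - fi (x + s *\<^sub>R axis i 1)
      = h * fij (x + s *\<^sub>R axis i 1 + t *\<^sub>R axis j 1)"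
    by blast
  with s show ?thesis by (intro exI[of _ s] exI[of _ t]) (simp add: algebra_simps)
qed

text \<open>Schwarz's theorem. Both mixed derivatives, taken at points near \<open>x\<close>, equal
  the same second difference divided by \<open>h n * h n\<close>. These points tend to
  \<open>x\<close>, so continuity at \<open>x\<close> identifies the two limits.\<close>

lemma mixed_pderiv_commute:
  assumes fi: "\<And>y. has_pderiv i f (fi y) y" and fij: "\<And>y. has_pderiv j fi (fij y) y"
    and fj: "\<And>y. has_pderiv j f (fj y) y" and fji: "\<And>y. has_pderiv i fj (fji y) y"
    and cont: "isCont fij x" "isCont fji x"
  shows "fij x = fji x"
proof -
  define h :: "nat \<Rightarrow> real" where "h n = inverse (real (Suc n))" for n
  have h0: "h \<longlonglongrightarrow> 0" unfolding h_def by (rule LIMSEQ_inverse_real_of_nat)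
  have "\<forall>n. \<exists>s t. \<bar>s\<bar> \<le> \<bar>h n\<bar> \<and> \<bar>t\<bar> \<le> \<bar>h n\<bar> \<and>
    f (x + h n *\<^sub>R axis i 1 + h n *\<^sub>R axis j 1) - f (x + h n *\<^sub>R axis i 1) - f (x + h n *\<^sub>R axis j 1) + f x
      = h n * h n * fij (x + s *\<^sub>R axis i 1 + t *\<^sub>R axis j 1)"
    using mixed_difference_quotient[OF fi fij] by blast
  then obtain s t where st: "\<And>n. \<bar>s n\<bar> \<le> \<bar>h n\<bar>" "\<And>n. \<bar>t n\<bar> \<le> \<bar>h n\<bar>"
    "\<And>n. f (x + h n *\<^sub>R axis i 1 + h n *\<^sub>R axis j 1) - f (x + h n *\<^sub>R axis i 1) - f (x + h n *\<^sub>R axis j 1) + f x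
      = h n * h n * fij (x + s n *\<^sub>R axis i 1 + t n *\<^sub>R axis j 1)"
    by metis
  have "\<forall>n. \<exists>s t. \<bar>s\<bar> \<le> \<bar>h n\<bar> \<and> \<bar>t\<bar> \<le> \<bar>h n\<bar> \<and>
    f (x + h n *\<^sub>R axis j 1 + h n *\<^sub>R axis i 1) - f (x + h n *\<^sub>R axis j 1) - f (x + h n *\<^sub>R axis i 1) + f x
      = h n * h n * fji (x + s *\<^sub>R axis j 1 + t *\<^sub>R axis i 1)"
    using mixed_difference_quotient[OF fj fji] by blast
  then obtain s' t' where st': "\<And>n. \<bar>s' n\<bar> \<le> \<bar>h n\<bar>" "\<And>n. \<bar>t' n\<bar> \<le> \<bar>h n\<bar>"
    "\<And>n. f (x + h n *\<^sub>R axis j 1 + h n *\<^sub>R axis i 1) - f (x + h n *\<^sub>R axis j 1) - f (x + h n *\<^sub>R axis i 1) + f x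
      = h n * h n * fji (x + s' n *\<^sub>R axis j 1 + t' n *\<^sub>R axis i 1)"
    by metis
  have z: "a \<longlonglongrightarrow> 0" if "\<And>n. \<bar>a n\<bar> \<le> \<bar>h n\<bar>" for a :: "nat \<Rightarrow> real"
    using Lim_null_comparison[of a "\<lambda>n. \<bar>h n\<bar>" sequentially] that h0 tendsto_rabs_zero by auto
  have eq: "fij (x + s n *\<^sub>R axis i 1 + t n *\<^sub>R axis j 1) = fji (x + s' n *\<^sub>R axis j 1 + t' n *\<^sub>R axis i 1)" for n
  proof -
    have "h n * h n \<noteq> 0" unfolding h_def by simp
    have "x + h n *\<^sub>R axis j 1 + h n *\<^sub>R axis i 1 = x + h n *\<^sub>R axis i 1 + h n *\<^sub>R axis j 1"
      by (simp add: algebra_simps)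
    then have "h n * h n * fij (x + s n *\<^sub>R axis i 1 + t n *\<^sub>R axis j 1)
        = h n * h n * fji (x + s' n *\<^sub>R axis j 1 + t' n *\<^sub>R axis i 1)"
      unfolding st(3)[symmetric] st'(3)[symmetric] by (simp only:)
    with \<open>h n * h n \<noteq> 0\<close> show ?thesis by simp
  qed
  have "(\<lambda>n. x + s n *\<^sub>R axis i 1 + t n *\<^sub>R axis j 1) \<longlonglongrightarrow> x + 0 *\<^sub>R axis i 1 + 0 *\<^sub>R axis j 1"
    by (intro tendsto_intros z st)
  then have l1: "(\<lambda>n. fij (x + s n *\<^sub>R axis i 1 + t n *\<^sub>R axis j 1)) \<longlonglongrightarrow> fij x"
    using isCont_tendsto_compose[OF cont(1)] by simp
  have "(\<lambda>n. x + s' n *\<^sub>R axis j 1 + t' n *\<^sub>R axis i 1) \<longlonglongrightarrow> x + 0 *\<^sub>R axis j 1 + 0 *\<^sub>R axis i 1"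
    by (intro tendsto_intros z st')
  then have "(\<lambda>n. fji (x + s' n *\<^sub>R axis j 1 + t' n *\<^sub>R axis i 1)) \<longlonglongrightarrow> fji x"
    using isCont_tendsto_compose[OF cont(2)] by simp
  with l1 show ?thesis unfolding eq by (rule LIMSEQ_unique)
qed

section \<open>Smoothness classes\<close>

lemma differentiable_imp_continuous_UNIV:
  "(\<And>x. f differentiable (at x)) \<Longrightarrow> continuous_on UNIV f"
  by (simp add: continuous_at_imp_continuous_on differentiable_imp_continuous_within)

lemma C_k_continuous: "C_k k f \<Longrightarrow> continuous_on UNIV f"
  by (cases k) (auto intro: differentiable_imp_continuous_UNIV)

lemma C_k_Suc_imp: "C_k (Suc k) f \<Longrightarrow> C_k k f"
proof (induction k arbitrary: f)
  case 0
  then show ?case by (auto intro: differentiable_imp_continuous_UNIV)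
next
  case (Suc k)
  from Suc.prems have "\<forall>x. f differentiable (at x)" "\<And>j. C_k (Suc k) (partial_deriv j f)" by auto
  with Suc.IH show ?case by auto
qed

section \<open>Stability of the smoothness classes under sums, products and affine
  substitutions\<close>

lemma partial_deriv_add:
  assumes "f differentiable (at x)" "g differentiable (at x)"
  shows "partial_deriv j (\<lambda>x. f x + g x) x = partial_deriv j f x + partial_deriv j g x"
  unfolding partial_deriv_def
  using fun_cong[OF frechet_derivative_at[OF has_derivative_add[OF assms[unfolded frechet_derivative_works]]], of "axis j 1"]
  by simp

lemma partial_deriv_mult:
  fixes f g :: "real^'n::finite \<Rightarrow> real"
  assumes "f differentiable (at x)" "g differentiable (at x)"
  shows "partial_deriv j (\<lambda>x. f x * g x) x = f x * partial_deriv j g x + partial_deriv j f x * g x"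
  unfolding partial_deriv_def
  using fun_cong[OF frechet_derivative_at[OF has_derivative_mult[OF assms[unfolded frechet_derivative_works]]], of "axis j 1"]
  by simp

text \<open>One substitution covers both later uses: positive \<open>c\<close> rescales a bump
  function, and \<open>c = -1\<close> gives the reflection under a convolution integral.\<close>

lemma partial_deriv_affine:
  fixes f :: "real^'n::finite \<Rightarrow> real"
  assumes f: "\<And>x. f differentiable (at x)"
  shows "(\<lambda>y. f (c *\<^sub>R y + a)) differentiable (at x)"
    and "partial_deriv j (\<lambda>y. f (c *\<^sub>R y + a)) x = c * partial_deriv j f (c *\<^sub>R x + a)"
proof -
  let ?f' = "frechet_derivative f (at (c *\<^sub>R x + a))"
  have f': "(f has_derivative ?f') (at (c *\<^sub>R x + a))"
    using f frechet_derivative_works by blast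
  have "((\<lambda>y. c *\<^sub>R y + a) has_derivative (\<lambda>h. c *\<^sub>R h)) (at x)"
    by (auto intro!: derivative_eq_intros)
  from has_derivative_compose[OF this f']
  have d: "((\<lambda>y. f (c *\<^sub>R y + a)) has_derivative (\<lambda>h. ?f' (c *\<^sub>R h))) (at x)" .
  then show "(\<lambda>y. f (c *\<^sub>R y + a)) differentiable (at x)"
    unfolding differentiable_def by blast
  from fun_cong[OF frechet_derivative_at[OF d], of "axis j 1"]
  have "partial_deriv j (\<lambda>y. f (c *\<^sub>R y + a)) x = ?f' (c *\<^sub>R axis j 1)"
    unfolding partial_deriv_def by simp
  then show "partial_deriv j (\<lambda>y. f (c *\<^sub>R y + a)) x = c * partial_deriv j f (c *\<^sub>R x + a)"
    using linear_scale[OF has_derivative_linear[OF f']] by (simp add: partial_deriv_def)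
qed

lemma C_k_const: "C_k k (\<lambda>x::real^'a::finite. c)"
proof (induction k arbitrary: c)
  case (Suc k)
  have "partial_deriv j (\<lambda>x::real^'a. c) = (\<lambda>x. 0)" for j
    by (rule ext) (simp add: partial_deriv_def)
  then show ?case using Suc.IH by auto
qed auto

lemma C_k_add: "C_k k f \<Longrightarrow> C_k k g \<Longrightarrow> C_k k (\<lambda>x. f x + g x)"
proof (induction k arbitrary: f g)
  case 0
  then show ?case by (auto intro: continuous_on_add)
next
  case (Suc k)
  then have d: "\<And>x. f differentiable (at x)" "\<And>x. g differentiable (at x)" by auto
  have "partial_deriv j (\<lambda>x. f x + g x) = (\<lambda>x. partial_deriv j f x + partial_deriv j g x)" for j
    using partial_deriv_add[OF d] by blast
  with Suc d show ?case by auto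
qed

lemma C_k_mult:
  fixes f g :: "real^'n::finite \<Rightarrow> real"
  shows "C_k k f \<Longrightarrow> C_k k g \<Longrightarrow> C_k k (\<lambda>x. f x * g x)"
proof (induction k arbitrary: f g)
  case 0
  then show ?case by (auto intro: continuous_on_mult)
next
  case (Suc k)
  then have d: "\<And>x. f differentiable (at x)" "\<And>x. g differentiable (at x)" by auto
  have "partial_deriv j (\<lambda>x. f x * g x) = (\<lambda>x. f x * partial_deriv j g x + partial_deriv j f x * g x)" for j
    using partial_deriv_mult[OF d] by blast
  moreover have "C_k k f" "C_k k g" using Suc.prems C_k_Suc_imp by blast+
  ultimately show ?case using Suc d by (auto intro!: C_k_add differentiable_mult)
qed

lemma C_k_affine:
  fixes f :: "real^'n::finite \<Rightarrow> real"
  shows "C_k k f \<Longrightarrow> C_k k (\<lambda>y. f (c *\<^sub>R y + a))"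
proof (induction k arbitrary: f)
  case 0
  have "continuous_on UNIV (\<lambda>y. c *\<^sub>R y + a)" by (intro continuous_intros)
  with 0 show ?case
    using continuous_on_compose2[of UNIV f UNIV] by auto
next
  case (Suc k)
  then have d: "\<And>x. f differentiable (at x)" by auto
  have "partial_deriv j (\<lambda>y. f (c *\<^sub>R y + a)) = (\<lambda>y. c * partial_deriv j f (c *\<^sub>R y + a))" for j
    using partial_deriv_affine(2)[OF d] by blast
  with Suc show ?case by (auto intro!: C_k_mult C_k_const partial_deriv_affine(1)[OF d])
qed

lemma smooth_partial_deriv: "smooth f \<Longrightarrow> smooth (partial_deriv j f)"
  unfolding smooth_def by (metis C_k.simps(2))

lemma smooth_differentiable: "smooth f \<Longrightarrow> f differentiable (at x)"
  unfolding smooth_def by (metis C_k.simps(2))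

lemma smooth_continuous: "smooth f \<Longrightarrow> continuous_on UNIV f"
  unfolding smooth_def by (metis C_k.simps(1))

lemma smooth_mult:
  "smooth f \<Longrightarrow> smooth (g :: real^'n::finite \<Rightarrow> real) \<Longrightarrow> smooth (\<lambda>x. f x * g x)"
  unfolding smooth_def by (simp add: C_k_mult)

lemma smooth_cmult: "smooth (g :: real^'n::finite \<Rightarrow> real) \<Longrightarrow> smooth (\<lambda>x. c * g x)"
  unfolding smooth_def by (simp add: C_k_mult C_k_const)

lemma smooth_affine:
  "smooth (f :: real^'n::finite \<Rightarrow> real) \<Longrightarrow> smooth (\<lambda>y. f (c *\<^sub>R y + a))"
  unfolding smooth_def by (simp add: C_k_affine)

text \<open>A closure is compact exactly when the set is bounded. A radius is easier to carry along
  than a support: derivatives keep it, and translations change it by the triangle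
  inequality.\<close>

lemma test_function_iff:
  "test_function f \<longleftrightarrow> smooth f \<and> (\<exists>r. \<forall>x. norm x > r \<longrightarrow> f x = 0)"
proof -
  have "compact (closure {x. f x \<noteq> 0}) \<longleftrightarrow> (\<exists>r. \<forall>x. norm x > r \<longrightarrow> f x = 0)"
    unfolding compact_closure bounded_iff by (auto simp: not_le[symmetric])
  then show ?thesis unfolding test_function_def by blast
qed

text \<open>The region outside the closed ball is open, so \<open>f\<close> vanishes on a piece of
  the line around \<open>x\<close>. Hence the radius of \<open>f\<close> also serves its
  derivative.\<close>

lemma has_pderiv_eq_0:
  assumes "has_pderiv j f d x" "\<And>y. norm y > r \<Longrightarrow> f y = 0" "norm x > r"
  shows "d = 0"
proof -
  have "\<forall>\<^sub>F t in nhds (0::real). norm (x + t *\<^sub>R axis j 1) > r"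
  proof (rule order_tendstoD(1))
    have "((\<lambda>t. norm (x + t *\<^sub>R axis j 1)) \<longlongrightarrow> norm (x + 0 *\<^sub>R axis j 1)) (nhds (0::real))"
      by (intro tendsto_intros filterlim_ident)
    then show "((\<lambda>t. norm (x + t *\<^sub>R axis j 1)) \<longlongrightarrow> norm x) (nhds (0::real))" by simp
  qed (use assms in simp)
  then have "\<forall>\<^sub>F t in nhds (0::real). f (x + t *\<^sub>R axis j 1) = 0"
    by eventually_elim (use assms in auto)
  from DERIV_cong_ev[OF refl this refl, of d] assms(1)
  have "((\<lambda>t. 0::real) has_real_derivative d) (at 0)" unfolding has_pderiv_def by blast
  then show ?thesis using DERIV_unique[OF _ DERIV_const] by blast
qed

lemma test_function_partial_deriv:
  assumes "test_function f"
  shows "test_function (partial_deriv j f)"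
proof -
  from assms obtain r where s: "smooth f" and r: "\<And>x. norm x > r \<Longrightarrow> f x = 0"
    unfolding test_function_iff by blast
  have "partial_deriv j f x = 0" if "norm x > r" for x
    using has_pderiv_eq_0[OF differentiable_imp_has_pderiv[OF smooth_differentiable[OF s]], of r] r that by blast
  then show ?thesis
    using smooth_partial_deriv[OF s] unfolding test_function_iff by blast
qed

lemma test_function_reflect:
  assumes "test_function f"
  shows "test_function (\<lambda>y. f (x - y))"
proof -
  from assms obtain r where s: "smooth f" and r: "\<And>x. norm x > r \<Longrightarrow> f x = 0"
    unfolding test_function_iff by blast
  have "f (x - y) = 0" if "norm y > r + norm x" for y
    by (rule r) (use that norm_triangle_ineq2[of y x] in \<open>simp add: norm_minus_commute\<close>)
  moreover have "smooth (\<lambda>y. f (x - y))"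
    using smooth_affine[OF s, of "-1" x] by simp
  ultimately show ?thesis unfolding test_function_iff by blast
qed

lemma partial_deriv_reflect:
  assumes "test_function f"
  shows "partial_deriv j (\<lambda>y. f (x - y)) y = - partial_deriv j f (x - y)"
  using partial_deriv_affine(2)[of f j "-1" x y] assms smooth_differentiable
  unfolding test_function_def by fastforce

lemma has_pderiv_test_function:
  "test_function f \<Longrightarrow> has_pderiv j f (partial_deriv j f x) x"
  unfolding test_function_def by (intro differentiable_imp_has_pderiv smooth_differentiable) simp

lemma C_2_partial_deriv_commute:
  fixes f :: "real^'n::finite \<Rightarrow> real"
  assumes "C_k 2 f"
  shows "partial_deriv i (partial_deriv j f) x = partial_deriv j (partial_deriv i f) x"
proof -
  have f: "\<And>x. f differentiable (at x)" "\<And>j x. partial_deriv j f differentiable (at x)"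
    "\<And>i j. continuous_on UNIV (partial_deriv i (partial_deriv j f))"
    using assms unfolding numeral_2_eq_2 by simp_all
  show ?thesis
    by (rule mixed_pderiv_commute[of j f _ i _ _ ])
      (use f in \<open>auto intro: differentiable_imp_has_pderiv simp: continuous_on_eq_continuous_at\<close>)
qed

section \<open>Convolution with compactly supported kernels\<close>

lemma continuous_zero_outside_bounded:
  fixes g :: "'a::euclidean_space \<Rightarrow> real"
  assumes "continuous_on UNIV g" "\<And>x. norm x > s \<Longrightarrow> g x = 0"
  obtains B where "B \<ge> 0" "\<And>x. \<bar>g x\<bar> \<le> B"
proof -
  have "compact (g ` cball 0 s)"
    using assms(1) by (intro compact_continuous_image) (auto intro: continuous_on_subset)
  then obtain B where B: "\<forall>x\<in>cball 0 s. \<bar>g x\<bar> \<le> B"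
    by (auto dest!: compact_imp_bounded simp: bounded_iff)
  \<comment> \<open>For negative \<open>s\<close> the ball is empty and \<open>B\<close> is
    arbitrary; outside the ball the bound has to be at least 0.\<close>
  have "\<bar>g x\<bar> \<le> max B 0" for x
    using B assms(2)[of x] by (cases "norm x \<le> s") (auto simp: le_max_iff_disj)
  then show ?thesis using that[of "max B 0"] by simp
qed

section \<open>Invariance of Lebesgue measure under reflections and translations\<close>

lemma nn_integral_lborel_affine_pm:
  fixes h :: "'a::euclidean_space \<Rightarrow> ennreal"
  assumes [measurable]: "h \<in> borel_measurable borel" and c: "\<bar>c\<bar> = 1"
  shows "(\<integral>\<^sup>+x. h (t + c *\<^sub>R x) \<partial>lborel) = (\<integral>\<^sup>+x. h x \<partial>lborel)"
proof -
  have "c \<noteq> 0" using c by auto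
  show ?thesis
    by (subst (2) lborel_affine[OF \<open>c \<noteq> 0\<close>, of t]) (simp add: nn_integral_density nn_integral_distr c)
qed

lemma nn_integral_lborel_reflect:
  fixes h :: "'a::euclidean_space \<Rightarrow> ennreal"
  assumes "h \<in> borel_measurable borel"
  shows "(\<integral>\<^sup>+y. h (x - y) \<partial>lborel) = (\<integral>\<^sup>+y. h y \<partial>lborel)"
  using nn_integral_lborel_affine_pm[OF assms, of "-1" x] by simp

lemma nn_integral_lborel_translate:
  fixes h :: "'a::euclidean_space \<Rightarrow> ennreal"
  assumes "h \<in> borel_measurable borel"
  shows "(\<integral>\<^sup>+y. h (y - x) \<partial>lborel) = (\<integral>\<^sup>+y. h y \<partial>lborel)"
  using nn_integral_lborel_affine_pm[OF assms, of 1 "-x"] by simp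

lemma integral_lborel_reflect:
  fixes h :: "'a::euclidean_space \<Rightarrow> real"
  assumes [measurable]: "h \<in> borel_measurable borel"
  shows "(LINT y|lborel. h (x - y)) = (LINT y|lborel. h y)"
proof -
  have "(LINT y|lborel. h y) = (LINT y|density (distr lborel borel (\<lambda>y. x + (-1) *\<^sub>R y)) (\<lambda>_. ennreal (\<bar>-1\<bar> ^ DIM('a))). h y)"
    by (subst lborel_affine[of "-1" x]) auto
  also have "\<dots> = (LINT y|lborel. h (x - y))"
    by (simp add: integral_distr one_ennreal_def[symmetric] density_1)
  finally show ?thesis by simp
qed

text \<open>Centred balls suffice because each compact set lies in one of them. Borel measurability
  is demanded so that product measurability is available for Fubini.\<close>

definition loc_integrable :: "('a::euclidean_space \<Rightarrow> real) \<Rightarrow> bool" where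
  "loc_integrable f \<longleftrightarrow> f \<in> borel_measurable borel \<and> (\<forall>r. set_integrable lborel (cball 0 r) f)"

lemma loc_integrable_const: "loc_integrable (\<lambda>x. c)"
proof -
  have "emeasure lborel (cball (0::'a) r) < \<infinity>" for r
    by (rule emeasure_bounded_finite) simp
  then show ?thesis
    unfolding loc_integrable_def set_integrable_def
    by (auto intro!: integrable_scaleR_left integrable_mult_left)
qed

text \<open>The rough factor \<open>f\<close> stays in place and the kernel \<open>g\<close> is
  translated, so differentiation in \<open>x\<close> touches \<open>g\<close> alone.\<close>

definition conv :: "('a::euclidean_space \<Rightarrow> real) \<Rightarrow> ('a \<Rightarrow> real) \<Rightarrow> 'a \<Rightarrow> real" where
  "conv f g x = (LINT y|lborel. f y * g (x - y))"

text \<open>If \<open>x\<close> has norm at most \<open>M\<close> and \<open>g (x - y)\<close> is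
  nonzero, then \<open>y\<close> lies in the ball of radius \<open>M + s\<close>. The dominating
  function is thus common to all such \<open>x\<close>. Continuity of \<open>g\<close> is left out
  so that difference quotients of kernels can take its place.\<close>

lemma conv_integrand_bound:
  fixes g :: "'a::euclidean_space \<Rightarrow> real"
  assumes g: "\<And>x. norm x > s \<Longrightarrow> g x = 0" "\<And>x. \<bar>g x\<bar> \<le> B" and x: "norm x \<le> M"
  shows "norm (f y * g (x - y)) \<le> B * \<bar>indicat_real (cball 0 (M + s)) y *\<^sub>R f y\<bar>"
proof (cases "norm y \<le> M + s")
  case True
  then show ?thesis
    using mult_left_mono[OF g(2)[of "x - y"], of "\<bar>f y\<bar>"] by (simp add: abs_mult mult.commute)
next
  case False
  then have "norm (x - y) > s" using norm_triangle_ineq2[of y x] x by (simp add: norm_minus_commute)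
  then show ?thesis using False g(1) by simp
qed

lemma loc_integrable_dominant:
  assumes "loc_integrable f"
  shows "integrable lborel (\<lambda>y. B * \<bar>indicat_real (cball 0 r) y *\<^sub>R f y\<bar>)"
  using assms unfolding loc_integrable_def set_integrable_def
  by (intro integrable_mult_right integrable_abs) blast

lemma conv_integrable:
  assumes f: "loc_integrable f" and g: "continuous_on UNIV g" "\<And>x. norm x > s \<Longrightarrow> g x = 0"
  shows "integrable lborel (\<lambda>y. f y * g (x - y))"
proof -
  obtain B where B: "B \<ge> 0" "\<And>x. \<bar>g x\<bar> \<le> B"
    using continuous_zero_outside_bounded[OF g] by blast
  have [measurable]: "f \<in> borel_measurable borel" "g \<in> borel_measurable borel"
    using f g by (auto simp: loc_integrable_def intro: borel_measurable_continuous_onI)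
  show ?thesis
    by (rule Bochner_Integration.integrable_bound[OF loc_integrable_dominant[OF f, of B "norm x + s"]])
      (use conv_integrand_bound[where g=g and s=s and B=B and M="norm x" and x=x and f=f, OF g(2) B(2)] B(1)
        in \<open>auto simp: abs_mult\<close>)
qed

lemma continuous_on_conv:
  assumes f: "loc_integrable f" and g: "continuous_on UNIV g" "\<And>x. norm x > s \<Longrightarrow> g x = 0"
  shows "continuous_on UNIV (conv f g)"
proof -
  obtain B where B: "B \<ge> 0" "\<And>x. \<bar>g x\<bar> \<le> B"
    using continuous_zero_outside_bounded[OF g] by blast
  have [measurable]: "f \<in> borel_measurable borel" "g \<in> borel_measurable borel"
    using f g by (auto simp: loc_integrable_def intro: borel_measurable_continuous_onI)
  have "(\<lambda>n. conv f g (X n)) \<longlonglongrightarrow> conv f g x" if X: "X \<longlonglongrightarrow> x" for X x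
  proof -
    obtain M where M: "\<And>n. norm (X n) \<le> M"
      using convergent_imp_Bseq[OF convergentI[OF X]] unfolding Bseq_def by blast
    show ?thesis unfolding conv_def
    proof (rule integral_dominated_convergence[OF _ _ loc_integrable_dominant[OF f, of B "M + s"]])
      show "AE y in lborel. (\<lambda>n. f y * g (X n - y)) \<longlonglongrightarrow> f y * g (x - y)"
        by (intro AE_I2 tendsto_mult tendsto_const continuous_on_tendsto_compose[OF g(1)] tendsto_diff X) auto
      show "AE y in lborel. norm (f y * g (X n - y)) \<le> B * \<bar>indicat_real (cball 0 (M + s)) y *\<^sub>R f y\<bar>" for n
        by (intro AE_I2 conv_integrand_bound g(2) B(2) M)
    qed simp_all
  qed
  then show ?thesis
    by (simp add: continuous_on_sequentially comp_def)
qed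

text \<open>Dominated convergence for the difference quotients \<open>Q n\<close> of the kernel. By
  the mean value theorem they are bounded by the supremum of the derivative, and all of them vanish
  outside the radius \<open>s + T\<close>, where \<open>T\<close> bounds the step sizes. The locally
  integrable \<open>f\<close> on one ball therefore dominates.\<close>

lemma has_pderiv_conv:
  fixes g :: "real^'n::finite \<Rightarrow> real"
  assumes f: "loc_integrable f" and g: "\<And>y. has_pderiv j g (g' y) y" "continuous_on UNIV g"
    "continuous_on UNIV g'" "\<And>x. norm x > s \<Longrightarrow> g x = 0"
  shows "has_pderiv j (conv f g) (conv f g' x) x"
proof -
  have g'0: "\<And>x. norm x > s \<Longrightarrow> g' x = 0"
    using has_pderiv_eq_0[OF g(1) g(4)] by blast
  obtain B where B: "B \<ge> 0" "\<And>x. \<bar>g' x\<bar> \<le> B"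
    using continuous_zero_outside_bounded[OF g(3) g'0] by blast
  have [measurable]: "f \<in> borel_measurable borel" "g \<in> borel_measurable borel" "g' \<in> borel_measurable borel"
    using f g by (auto simp: loc_integrable_def intro: borel_measurable_continuous_onI)
  let ?e = "axis j 1 :: real^'n"
  have "(\<lambda>n. (conv f g (x + h n *\<^sub>R ?e) - conv f g x) / h n) \<longlonglongrightarrow> conv f g' x"
    if h: "h \<longlonglongrightarrow> 0" "\<And>n. h n \<noteq> 0" for h :: "nat \<Rightarrow> real"
  proof -
    obtain T where T: "\<And>n. \<bar>h n\<bar> \<le> T"
      using convergent_imp_Bseq[OF convergentI[OF h(1)]] unfolding Bseq_def by auto
    define Q where "Q n z = (g (z + h n *\<^sub>R ?e) - g z) / h n" for n z
    have QB: "\<bar>Q n z\<bar> \<le> B" for n z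
    proof -
      obtain t where "g (z + h n *\<^sub>R ?e) - g z = h n * g' (z + t *\<^sub>R ?e)"
        using mean_value_pderiv[of j g g', OF g(1)] by blast
      then show ?thesis using h(2)[of n] B(2) unfolding Q_def by simp
    qed
    have Q0: "Q n z = 0" if "norm z > s + T" for n z
    proof -
      have "norm z \<le> norm (z + h n *\<^sub>R ?e) + norm (h n *\<^sub>R ?e)"
        using norm_triangle_ineq4[of "z + h n *\<^sub>R ?e" "h n *\<^sub>R ?e"] by simp
      moreover have "norm (h n *\<^sub>R ?e) \<le> T" using T[of n] by simp
      ultimately have "norm (z + h n *\<^sub>R ?e) > s" "norm z > s" using that T[of n] by linarith+
      then show ?thesis unfolding Q_def using g(4) by simp
    qed
    have eq: "(conv f g (x + h n *\<^sub>R ?e) - conv f g x) / h n = (LINT y|lborel. f y * Q n (x - y))" for n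
    proof -
      have "(LINT y|lborel. f y * Q n (x - y))
          = (LINT y|lborel. (f y * g (x + h n *\<^sub>R ?e - y) - f y * g (x - y)) / h n)"
        unfolding Q_def by (intro Bochner_Integration.integral_cong refl) (simp add: algebra_simps)
      then show ?thesis
        using conv_integrable[OF f g(2,4)] by (simp add: conv_def)
    qed
    have lim: "(\<lambda>n. Q n z) \<longlonglongrightarrow> g' z" for z
    proof -
      have "((\<lambda>t. (g (z + t *\<^sub>R ?e) - g z) / t) \<longlongrightarrow> g' z) (at 0)"
        using g(1)[of z] unfolding has_pderiv_def DERIV_def by simp
      then show ?thesis
        unfolding Q_def tendsto_at_iff_sequentially using h by (auto simp: comp_def)
    qed
    show ?thesis unfolding eq unfolding conv_def
    proof (rule integral_dominated_convergence[OF _ _ loc_integrable_dominant[OF f, of B "norm x + (s + T)"]])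
      show "AE y in lborel. (\<lambda>n. f y * Q n (x - y)) \<longlonglongrightarrow> f y * g' (x - y)"
        by (intro AE_I2 tendsto_mult tendsto_const lim)
      show "AE y in lborel. norm (f y * Q n (x - y))
          \<le> B * \<bar>indicat_real (cball 0 (norm x + (s + T))) y *\<^sub>R f y\<bar>" for n
        by (intro AE_I2 conv_integrand_bound Q0 QB order_refl)
    qed (simp_all add: Q_def)
  qed
  then show ?thesis
    unfolding has_pderiv_def DERIV_def tendsto_at_iff_sequentially by (auto simp: comp_def)
qed

lemma integrable_continuous_compact:
  fixes g :: "'a::euclidean_space \<Rightarrow> real"
  assumes "continuous_on UNIV g" "\<And>x. norm x > s \<Longrightarrow> g x = 0"
  shows "integrable lborel g"
proof -
  \<comment> \<open>The integrand is read as that of the convolution of 1 with the reflected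
    \<open>g\<close> at the point 0, which is already known to be integrable.\<close>
  have "continuous_on UNIV (\<lambda>x. g (- x))"
    by (rule continuous_on_compose2[OF assms(1)]) (auto intro: continuous_intros)
  then show ?thesis
    using conv_integrable[OF loc_integrable_const, of "\<lambda>x. g (- x)" s 1 0] assms(2) by simp
qed

text \<open>The convolution of \<open>g\<close> with the constant 1 is constant.\<close>

lemma integral_has_pderiv_eq_0:
  fixes g :: "real^'n::finite \<Rightarrow> real"
  assumes "\<And>y. has_pderiv j g (g' y) y" "continuous_on UNIV g"
    "continuous_on UNIV g'" "\<And>x. norm x > s \<Longrightarrow> g x = 0"
  shows "(LINT x|lborel. g' x) = 0"
proof -
  have c: "conv (\<lambda>x. 1) h = (\<lambda>x. LINT y|lborel. h y)" if "continuous_on UNIV h" for h :: "real^'n \<Rightarrow> real"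
    using integral_lborel_reflect[of h] that by (auto simp: conv_def borel_measurable_continuous_onI)
  have "has_pderiv j (conv (\<lambda>x. 1) g) (conv (\<lambda>x. 1) g' 0) 0"
    by (rule has_pderiv_conv[OF loc_integrable_const assms])
  then show ?thesis
    unfolding c[OF assms(2)] c[OF assms(3)] by (rule has_pderiv_unique[OF _ has_pderiv_const])
qed

section \<open>Mollification in L2\<close>

text \<open>A substitute for Minkowski's inequality from (s + t)^2 \<le> 2 s^2 + 2 t^2. It works
  with extended nonnegative integrals, hence without integrability side conditions, at the price of
  a factor 2 in each use.\<close>

lemma nn_integral_square_triangle:
  fixes a b c :: "'a \<Rightarrow> real"
  assumes [measurable]: "a \<in> borel_measurable M" "b \<in> borel_measurable M" "c \<in> borel_measurable M"
    and ab: "(\<integral>\<^sup>+x. ennreal ((a x - b x)\<^sup>2) \<partial>M) \<le> ennreal p" and bc: "(\<integral>\<^sup>+x. ennreal ((b x - c x)\<^sup>2) \<partial>M) \<le> ennreal q"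
    and "p \<ge> 0" "q \<ge> 0"
  shows "(\<integral>\<^sup>+x. ennreal ((a x - c x)\<^sup>2) \<partial>M) \<le> ennreal (2 * p + 2 * q)"
proof -
  have "(a x - c x)\<^sup>2 \<le> 2 * (a x - b x)\<^sup>2 + 2 * (b x - c x)\<^sup>2" for x
    using zero_le_power2[of "(a x - b x) - (b x - c x)"] by (simp add: power2_eq_square algebra_simps)
  then have "(\<integral>\<^sup>+x. ennreal ((a x - c x)\<^sup>2) \<partial>M)
      \<le> (\<integral>\<^sup>+x. ennreal (2 * (a x - b x)\<^sup>2 + 2 * (b x - c x)\<^sup>2) \<partial>M)"
    by (intro nn_integral_mono ennreal_leI)
  also have "\<dots> = 2 * (\<integral>\<^sup>+x. ennreal ((a x - b x)\<^sup>2) \<partial>M) + 2 * (\<integral>\<^sup>+x. ennreal ((b x - c x)\<^sup>2) \<partial>M)"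
    by (simp add: ennreal_mult nn_integral_add nn_integral_cmult)
  also have "\<dots> \<le> 2 * ennreal p + 2 * ennreal q"
    by (intro add_mono mult_left_mono ab bc) auto
  also have "\<dots> = ennreal (2 * p + 2 * q)"
    using assms by (simp add: ennreal_mult ennreal_plus)
  finally show ?thesis .
qed

lemma tendsto_0_le_ennreal:
  assumes "X \<longlonglongrightarrow> (0::ennreal)" "\<delta> > 0"
  shows "\<exists>n::nat. X n \<le> ennreal \<delta>"
proof -
  have "\<forall>\<^sub>F n in sequentially. X n < ennreal \<delta>"
    using order_tendstoD(2)[OF assms(1), of "ennreal \<delta>"] assms(2) by simp
  then show ?thesis by (meson eventually_sequentially less_imp_le order_refl)
qed

section \<open>Density of compactly supported continuous functions in L2\<close>

definition clamp_abs :: "nat \<Rightarrow> real \<Rightarrow> real" where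
  "clamp_abs k t = max (- real k) (min (real k) t)"

lemma clamp_abs_bound: "\<bar>clamp_abs k t\<bar> \<le> real k"
  unfolding clamp_abs_def by auto

lemma clamp_abs_id: "\<bar>t\<bar> \<le> real k \<Longrightarrow> clamp_abs k t = t"
  unfolding clamp_abs_def by auto

lemma abs_diff_clamp_abs_le: "\<bar>t - clamp_abs k t\<bar> \<le> \<bar>t\<bar>"
  unfolding clamp_abs_def by (auto simp: max_def min_def)

lemma continuous_on_clamp_abs: "continuous_on UNIV (clamp_abs k)"
  unfolding clamp_abs_def by (intro continuous_intros)

lemma measurable_clamp_abs [measurable]: "clamp_abs k \<in> borel_measurable borel"
  by (rule borel_measurable_continuous_onI[OF continuous_on_clamp_abs])

text \<open>Two approximations. Truncation at a large level \<open>k\<close> turns \<open>f\<close>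
  into a bounded \<open>F\<close>. Being measurable, \<open>F\<close> is an a.e. limit of continuous
  \<open>G n\<close>; truncating and cutting off these as well makes them dominated without losing
  continuity, since \<open>clamp_abs k\<close> is itself continuous.\<close>

lemma continuous_dense_L2:
  fixes f :: "'a::euclidean_space \<Rightarrow> real"
  assumes f[measurable]: "f \<in> borel_measurable borel" and fin: "(\<integral>\<^sup>+x. ennreal ((f x)\<^sup>2) \<partial>lborel) < \<infinity>"
    and supp: "\<And>x. norm x > R \<Longrightarrow> f x = 0" and \<delta>: "\<delta> > 0"
  obtains g s where "continuous_on UNIV g" "\<And>x. norm x > s \<Longrightarrow> g x = 0"
    "(\<integral>\<^sup>+x. ennreal ((f x - g x)\<^sup>2) \<partial>lborel) \<le> ennreal \<delta>"
proof -
  have "(\<lambda>k. \<integral>\<^sup>+x. ennreal ((f x - clamp_abs k (f x))\<^sup>2) \<partial>lborel) \<longlonglongrightarrow> (\<integral>\<^sup>+x. 0 \<partial>(lborel::'a measure))"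
  proof (rule nn_integral_dominated_convergence[where w="\<lambda>x. ennreal ((f x)\<^sup>2)"])
    show "AE x in lborel. ennreal ((f x - clamp_abs k (f x))\<^sup>2) \<le> ennreal ((f x)\<^sup>2)" for k
      by (intro AE_I2 ennreal_leI) (simp add: abs_diff_clamp_abs_le flip: abs_le_square_iff)
    show "AE x in lborel. (\<lambda>k. ennreal ((f x - clamp_abs k (f x))\<^sup>2)) \<longlonglongrightarrow> 0"
    proof (intro AE_I2 tendsto_eventually)
      fix x
      obtain K where "\<bar>f x\<bar> \<le> real K" using real_arch_simple by blast
      then show "\<forall>\<^sub>F k in sequentially. ennreal ((f x - clamp_abs k (f x))\<^sup>2) = 0"
        by (intro eventually_sequentiallyI[of K]) (simp add: clamp_abs_id)
    qed
  qed (use fin in auto)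
  \<comment> \<open>With \<delta>/4 for each of the two approximations, the factors 2 of
    \<open>nn_integral_square_triangle\<close> add up to exactly \<delta>.\<close>
  then obtain k where k: "(\<integral>\<^sup>+x. ennreal ((f x - clamp_abs k (f x))\<^sup>2) \<partial>lborel) \<le> ennreal (\<delta>/4)"
    using tendsto_0_le_ennreal[of _ "\<delta>/4"] \<delta> by auto
  define F where "F x = clamp_abs k (f x)" for x
  have [measurable]: "F \<in> borel_measurable borel" unfolding F_def by simp
  have F0: "F x = 0" if "norm x > R" for x
    using supp[OF that] unfolding F_def by (simp add: clamp_abs_id)
  have "F \<in> borel_measurable lebesgue" by (rule measurable_completion) simp
  then have "F measurable_on UNIV" by (rule lebesgue_measurable_imp_measurable_on) simp
  then obtain N G where N: "negligible N" and G: "\<And>n. continuous_on UNIV (G n)"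
    "\<And>x. x \<notin> N \<Longrightarrow> (\<lambda>n. G n x) \<longlonglongrightarrow> F x"
    unfolding measurable_on_def by auto
  \<comment> \<open>This equals 1 on the ball of radius \<open>R\<close>, outside of which
    \<open>F\<close> vanishes, so multiplication by it leaves the limit \<open>F\<close> unchanged.
    It is 0 from radius \<open>R + 1\<close> on.\<close>
  define cut where "cut x = max 0 (min 1 (R + 1 - norm x))" for x :: 'a
  define H where "H n x = clamp_abs k (G n x) * cut x" for n x
  have H_cont: "continuous_on UNIV (H n)" for n
    unfolding H_def cut_def
    by (intro continuous_intros continuous_on_compose2[OF continuous_on_clamp_abs] G(1)) auto
  have H0: "H n x = 0" if "norm x > R + 1" for n x
    using that unfolding H_def cut_def by simp
  have [measurable]: "H n \<in> borel_measurable borel" for n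
    by (rule borel_measurable_continuous_onI[OF H_cont])
  have HF: "\<bar>F x - H n x\<bar> \<le> 2 * real k" for n x
  proof -
    have "\<bar>H n x\<bar> \<le> real k * 1"
      unfolding H_def abs_mult by (intro mult_mono clamp_abs_bound) (auto simp: cut_def)
    moreover have "\<bar>F x\<bar> \<le> real k" unfolding F_def by (rule clamp_abs_bound)
    ultimately show ?thesis by linarith
  qed
  have ae: "AE x in lborel. x \<notin> N"
    using N AE_not_in negligible_iff_null_sets AE_completion_iff by blast
  have "(\<lambda>n. \<integral>\<^sup>+x. ennreal ((F x - H n x)\<^sup>2) \<partial>lborel) \<longlonglongrightarrow> (\<integral>\<^sup>+x. 0 \<partial>(lborel::'a measure))"
  proof (rule nn_integral_dominated_convergence
      [where w="\<lambda>x. ennreal ((2 * real k)\<^sup>2) * indicator (cball 0 (\<bar>R\<bar> + 1)) x"])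
    show "AE x in lborel. ennreal ((F x - H n x)\<^sup>2)
        \<le> ennreal ((2 * real k)\<^sup>2) * indicator (cball 0 (\<bar>R\<bar> + 1)) x" for n
    proof (rule AE_I2)
      fix x
      show "ennreal ((F x - H n x)\<^sup>2) \<le> ennreal ((2 * real k)\<^sup>2) * indicator (cball 0 (\<bar>R\<bar> + 1)) x"
      proof (cases "norm x \<le> \<bar>R\<bar> + 1")
        case True
        have "(F x - H n x)\<^sup>2 \<le> (2 * real k)\<^sup>2"
          using power_mono[OF HF abs_ge_zero, of x n 2] by simp
        then show ?thesis using True by (simp add: ennreal_leI)
      qed (use F0[of x] H0[of x n] in auto)
    qed
    show "AE x in lborel. (\<lambda>n. ennreal ((F x - H n x)\<^sup>2)) \<longlonglongrightarrow> 0"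
      using ae
    proof eventually_elim
      fix x assume "x \<notin> N"
      then have "(\<lambda>n. (F x - H n x)\<^sup>2) \<longlonglongrightarrow> (F x - clamp_abs k (F x) * cut x)\<^sup>2"
        unfolding H_def
        by (intro tendsto_intros continuous_on_tendsto_compose[OF continuous_on_clamp_abs] G(2)) auto
      moreover have "clamp_abs k (F x) * cut x = F x"
        using F0[of x] clamp_abs_bound[of k "f x"]
        by (cases "norm x > R") (auto simp: F_def clamp_abs_id cut_def)
      ultimately show "(\<lambda>n. ennreal ((F x - H n x)\<^sup>2)) \<longlonglongrightarrow> 0"
        using tendsto_ennrealI[of "\<lambda>n. (F x - H n x)\<^sup>2" 0 sequentially] by simp
    qed
    have "emeasure lborel (cball (0::'a) (\<bar>R\<bar> + 1)) < \<infinity>"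
      by (rule emeasure_bounded_finite) simp
    then show "(\<integral>\<^sup>+x. ennreal ((2 * real k)\<^sup>2) * indicator (cball 0 (\<bar>R\<bar> + 1)) x \<partial>(lborel::'a measure)) < \<infinity>"
      by (subst nn_integral_cmult_indicator) (auto simp: ennreal_mult_less_top)
    have [measurable]: "cball (0::'a) r \<in> sets borel" for r by simp
    show "(\<lambda>x. ennreal ((2 * real k)\<^sup>2) * indicator (cball (0::'a) (\<bar>R\<bar> + 1)) x) \<in> borel_measurable lborel"
      by measurable
  qed auto
  then obtain n where n: "(\<integral>\<^sup>+x. ennreal ((F x - H n x)\<^sup>2) \<partial>lborel) \<le> ennreal (\<delta>/4)"
    using tendsto_0_le_ennreal[of _ "\<delta>/4"] \<delta> by auto
  have "(\<integral>\<^sup>+x. ennreal ((f x - H n x)\<^sup>2) \<partial>lborel) \<le> ennreal (2 * (\<delta>/4) + 2 * (\<delta>/4))"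
    by (rule nn_integral_square_triangle[where b=F]) (use k n \<delta> in \<open>auto simp: F_def\<close>)
  then show ?thesis using that[OF H_cont H0] by simp
qed

text \<open>Translation does not change L2 distances, so \<open>f\<close> may be exchanged for a
  continuous, compactly supported \<open>g\<close>. For \<open>g\<close>, uniform continuity on a
  ball and the finite volume of that ball give the estimate.\<close>

lemma L2_translation_continuous:
  fixes f :: "'a::euclidean_space \<Rightarrow> real"
  assumes f[measurable]: "f \<in> borel_measurable borel" and fin: "(\<integral>\<^sup>+x. ennreal ((f x)\<^sup>2) \<partial>lborel) < \<infinity>"
    and supp: "\<And>x. norm x > R \<Longrightarrow> f x = 0" and \<delta>: "\<delta> > 0"
  obtains \<epsilon> where "\<epsilon> > 0" "\<And>z. norm z \<le> \<epsilon> \<Longrightarrow> (\<integral>\<^sup>+x. ennreal ((f (x - z) - f x)\<^sup>2) \<partial>lborel) \<le> ennreal \<delta>"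
proof -
  \<comment> \<open>The errors \<delta>/16 (f to g, twice) and \<delta>/8 (g to its translate)
    combine below to 2(2 \<delta>/16 + 2 \<delta>/8) + 2 \<delta>/16 = 7\<delta>/8.\<close>
  have "\<delta>/16 > 0" using \<delta> by simp
  from continuous_dense_L2[OF f fin supp this] obtain g s where g: "continuous_on UNIV g"
    "\<And>x. norm x > s \<Longrightarrow> g x = 0" and fg: "(\<integral>\<^sup>+x. ennreal ((f x - g x)\<^sup>2) \<partial>lborel) \<le> ennreal (\<delta>/16)"
    by metis
  have [measurable]: "g \<in> borel_measurable borel" using borel_measurable_continuous_onI[OF g(1)] .
  define V where "V = measure lborel (cball (0::'a) (s + 1))"
  have emV: "emeasure lborel (cball (0::'a) (s + 1)) = ennreal V"
    unfolding V_def using emeasure_bounded_finite[of "cball (0::'a) (s + 1)"]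
    by (intro emeasure_eq_ennreal_measure) auto
  have V0: "V \<ge> 0" unfolding V_def by simp
  \<comment> \<open>A pointwise bound \<eta> on a set of volume \<open>V\<close> costs
    \<open>\<eta>\<^sup>2 * V\<close>, which must not exceed \<delta>/8; \<open>V + 1\<close> keeps
    the quotient defined when the ball is null.\<close>
  define \<eta> where "\<eta> = sqrt (\<delta> / (8 * (V + 1)))"
  have \<eta>: "\<eta> > 0" "\<eta>\<^sup>2 = \<delta> / (8 * (V + 1))" unfolding \<eta>_def using \<delta> V0 by auto
  have \<eta>V: "\<eta>\<^sup>2 * V \<le> \<delta> / 8"
  proof -
    have "\<delta> / (8 * (V + 1)) * V = \<delta> / 8 * (V / (V + 1))" using V0 by (simp add: field_simps)
    also have "\<dots> \<le> \<delta> / 8 * 1" using V0 \<delta> by (intro mult_left_mono) auto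
    finally show ?thesis unfolding \<eta>(2) by simp
  qed
  \<comment> \<open>Shifts have norm at most 1. The difference of \<open>g\<close> and its translate
    lives on radius \<open>s + 1\<close>, and \<open>x - z\<close> then stays within
    \<open>s + 2\<close>.\<close>
  have "uniformly_continuous_on (cball 0 (s + 2)) g"
    by (rule compact_uniformly_continuous) (use g(1) in \<open>auto intro: continuous_on_subset\<close>)
  then obtain d where d: "d > 0" "\<And>x y. x \<in> cball 0 (s + 2) \<Longrightarrow> y \<in> cball 0 (s + 2) \<Longrightarrow>
      dist y x < d \<Longrightarrow> dist (g y) (g x) < \<eta>"
    unfolding uniformly_continuous_on_def using \<eta>(1) by metis
  define \<epsilon> where "\<epsilon> = min 1 (d / 2)"
  have "(\<integral>\<^sup>+x. ennreal ((f (x - z) - f x)\<^sup>2) \<partial>lborel) \<le> ennreal \<delta>" if z: "norm z \<le> \<epsilon>" for z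
  proof -
    have z1: "norm z \<le> 1" "norm z < d" using z d(1) unfolding \<epsilon>_def by auto
    have gz: "ennreal ((g (x - z) - g x)\<^sup>2) \<le> ennreal (\<eta>\<^sup>2) * indicator (cball 0 (s + 1)) x" for x
    proof (cases "norm x \<le> s + 1")
      case True
      have "norm (x - z) \<le> s + 2" using True z1 norm_triangle_ineq4[of x z] by linarith
      then have "\<bar>g (x - z) - g x\<bar> < \<eta>"
        using d(2)[of x "x - z"] True z1 unfolding mem_cball_0 by (simp add: dist_norm)
      then have "(g (x - z) - g x)\<^sup>2 \<le> \<eta>\<^sup>2" by (simp flip: abs_le_square_iff)
      then show ?thesis using True by (simp add: ennreal_leI)
    next
      case False
      then have "norm (x - z) > s" using z1 norm_triangle_ineq2[of x z] by linarith
      then show ?thesis using False g(2) by simp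
    qed
    have "(\<integral>\<^sup>+x. ennreal ((g (x - z) - g x)\<^sup>2) \<partial>lborel)
        \<le> (\<integral>\<^sup>+x. ennreal (\<eta>\<^sup>2) * indicator (cball 0 (s + 1)) x \<partial>(lborel::'a measure))"
      by (intro nn_integral_mono gz)
    also have "\<dots> = ennreal (\<eta>\<^sup>2 * V)" using V0 by (subst nn_integral_cmult_indicator) (auto simp: emV ennreal_mult)
    also have "\<dots> \<le> ennreal (\<delta>/8)" using \<eta>V by (rule ennreal_leI)
    finally have gg: "(\<integral>\<^sup>+x. ennreal ((g (x - z) - g x)\<^sup>2) \<partial>lborel) \<le> ennreal (\<delta>/8)" .
    have fgz: "(\<integral>\<^sup>+x. ennreal ((f (x - z) - g (x - z))\<^sup>2) \<partial>lborel) \<le> ennreal (\<delta>/16)"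
      using nn_integral_lborel_translate[of "\<lambda>x. ennreal ((f x - g x)\<^sup>2)" z] fg by simp
    have gf: "(\<integral>\<^sup>+x. ennreal ((g x - f x)\<^sup>2) \<partial>lborel) \<le> ennreal (\<delta>/16)"
      using fg by (simp add: power2_commute)
    have "(\<integral>\<^sup>+x. ennreal ((f (x - z) - g x)\<^sup>2) \<partial>lborel) \<le> ennreal (2 * (\<delta>/16) + 2 * (\<delta>/8))"
      by (rule nn_integral_square_triangle[where b="\<lambda>x. g (x - z)"]) (use fgz gg \<delta> in auto)
    from nn_integral_square_triangle[OF _ _ _ this gf] \<delta>
    have "(\<integral>\<^sup>+x. ennreal ((f (x - z) - f x)\<^sup>2) \<partial>lborel)
        \<le> ennreal (2 * (2 * (\<delta>/16) + 2 * (\<delta>/8)) + 2 * (\<delta>/16))"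
      by simp
    also have "\<dots> \<le> ennreal \<delta>" by (rule ennreal_leI) (use \<delta> in simp)
    finally show ?thesis .
  qed
  moreover have "\<epsilon> > 0" unfolding \<epsilon>_def using d(1) by simp
  ultimately show ?thesis using that by blast
qed

text \<open>The variance of \<open>a\<close> under the probability density \<rho> is nonnegative. An
  infinite right-hand side leaves nothing to show; otherwise the first moment exists because |a|
  \<le> 1 + a^2.\<close>

lemma jensen_square:
  fixes \<rho> a :: "'a \<Rightarrow> real"
  assumes [measurable]: "a \<in> borel_measurable M" and \<rho>: "integrable M \<rho>" "\<And>x. \<rho> x \<ge> 0" "(LINT x|M. \<rho> x) = 1"
  shows "ennreal ((LINT x|M. \<rho> x * a x)\<^sup>2) \<le> (\<integral>\<^sup>+x. ennreal (\<rho> x * (a x)\<^sup>2) \<partial>M)"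
proof (cases "(\<integral>\<^sup>+x. ennreal (\<rho> x * (a x)\<^sup>2) \<partial>M) = \<infinity>")
  case False
  have [measurable]: "\<rho> \<in> borel_measurable M" using \<rho>(1) by simp
  have i2: "integrable M (\<lambda>x. \<rho> x * (a x)\<^sup>2)"
    using False \<rho>(2) by (intro integrableI_nonneg) (auto simp: less_top)
  have i1: "integrable M (\<lambda>x. \<rho> x * a x)"
  proof (rule Bochner_Integration.integrable_bound[OF Bochner_Integration.integrable_add[OF \<rho>(1) i2]])
    have "\<bar>a x\<bar> \<le> 1 + (a x)\<^sup>2" for x
      using zero_le_power2[of "\<bar>a x\<bar> - 1"] zero_le_power2[of "a x"] by (simp add: power2_diff)
    from mult_left_mono[OF this \<rho>(2)]
    show "AE x in M. norm (\<rho> x * a x) \<le> norm (\<rho> x + \<rho> x * (a x)\<^sup>2)"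
      using \<rho>(2) by (intro AE_I2) (auto simp: abs_mult algebra_simps)
  qed simp
  define m where "m = (LINT x|M. \<rho> x * a x)"
  have "0 \<le> (LINT x|M. \<rho> x * (a x - m)\<^sup>2)"
    using \<rho>(2) by (intro integral_nonneg_AE AE_I2) simp
  also have "\<dots> = (LINT x|M. \<rho> x * (a x)\<^sup>2 - 2 * m * (\<rho> x * a x) + m\<^sup>2 * \<rho> x)"
    by (intro Bochner_Integration.integral_cong refl) (simp add: power2_eq_square algebra_simps)
  also have "\<dots> = (LINT x|M. \<rho> x * (a x)\<^sup>2) - 2 * m * m + m\<^sup>2 * 1"
    using i1 i2 \<rho>(1) by (simp add: m_def \<rho>(3))
  finally have "m\<^sup>2 \<le> (LINT x|M. \<rho> x * (a x)\<^sup>2)" by (simp add: power2_eq_square)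
  then show ?thesis
    using nn_integral_eq_integral[OF i2] \<rho>(2) by (simp add: m_def ennreal_leI)
qed simp

text \<open>The number \<epsilon> only bounds the radius of the support, which makes the notion
  monotone in it. Smoothness is kept apart and supplied by \<open>test_function\<close>, as the L2
  estimates rest on continuity and unit mass.\<close>

definition mollifier :: "real \<Rightarrow> ('a::euclidean_space \<Rightarrow> real) \<Rightarrow> bool" where
  "mollifier \<epsilon> \<rho> \<longleftrightarrow> continuous_on UNIV \<rho> \<and> (\<forall>x. \<rho> x \<ge> 0) \<and> (\<forall>x. norm x > \<epsilon> \<longrightarrow> \<rho> x = 0)
     \<and> (LINT x|lborel. \<rho> x) = 1"

lemma conv_flip:
  assumes "f \<in> borel_measurable borel" "g \<in> borel_measurable borel"
  shows "conv f g x = (LINT z|lborel. g z * f (x - z))"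
  using integral_lborel_reflect[of "\<lambda>z. g z * f (x - z)" x] assms
  by (simp add: conv_def mult.commute)

lemma loc_integrable_L2:
  fixes f :: "'a::euclidean_space \<Rightarrow> real"
  assumes [measurable]: "f \<in> borel_measurable borel"
    and fin: "\<And>r. (\<integral>\<^sup>+x. ennreal ((f x)\<^sup>2) * indicator (cball 0 r) x \<partial>lborel) < \<infinity>"
  shows "loc_integrable f"
  unfolding loc_integrable_def set_integrable_def
proof (intro conjI allI)
  fix r
  have 1: "integrable lborel (\<lambda>x::'a. indicat_real (cball 0 r) x * 1)"
    using loc_integrable_const[of 1, where 'a='a] unfolding loc_integrable_def set_integrable_def by simp
  have 2: "integrable lborel (\<lambda>x. indicat_real (cball 0 r) x * (f x)\<^sup>2)"
  proof (rule integrableI_nonneg)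
    have [measurable]: "cball (0::'a) r \<in> sets borel" by simp
    show "(\<lambda>x. indicat_real (cball 0 r) x * (f x)\<^sup>2) \<in> borel_measurable lborel" by measurable
    have "(\<integral>\<^sup>+x. ennreal (indicat_real (cball 0 r) x * (f x)\<^sup>2) \<partial>lborel)
      = (\<integral>\<^sup>+x. ennreal ((f x)\<^sup>2) * indicator (cball 0 r) x \<partial>lborel)"
      by (intro nn_integral_cong) (auto simp: indicator_def)
    then show "(\<integral>\<^sup>+x. ennreal (indicat_real (cball 0 r) x * (f x)\<^sup>2) \<partial>lborel) < \<infinity>"
      using fin by simp
  qed auto
  have "\<bar>f x\<bar> \<le> 1 + (f x)\<^sup>2" for x
    using zero_le_power2[of "\<bar>f x\<bar> - 1"] zero_le_power2[of "f x"] by (simp add: power2_diff)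
  then show "integrable lborel (\<lambda>x. indicat_real (cball 0 r) x *\<^sub>R f x)"
    by (intro Bochner_Integration.integrable_bound[OF Bochner_Integration.integrable_add[OF 1 2]])
      (auto simp: indicator_def intro: order_trans)
qed simp

text \<open>The error at \<open>x\<close> is the \<rho>-average of \<open>f (x - z) - f x\<close>.
  Jensen's inequality moves the square inside the average, Fubini integrates in \<open>x\<close>
  first, and the averaged shifts all have norm at most \<epsilon>.\<close>

lemma mollifier_L2_global:
  fixes f :: "'a::euclidean_space \<Rightarrow> real"
  assumes f[measurable]: "f \<in> borel_measurable borel" and fin: "(\<integral>\<^sup>+x. ennreal ((f x)\<^sup>2) \<partial>lborel) < \<infinity>"
    and \<rho>: "mollifier \<epsilon> \<rho>"
    and tr: "\<And>z. norm z \<le> \<epsilon> \<Longrightarrow> (\<integral>\<^sup>+x. ennreal ((f (x - z) - f x)\<^sup>2) \<partial>lborel) \<le> ennreal \<delta>"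
  shows "(\<integral>\<^sup>+x. ennreal ((conv f \<rho> x - f x)\<^sup>2) \<partial>lborel) \<le> ennreal \<delta>"
proof -
  have c: "continuous_on UNIV \<rho>" and \<rho>0: "\<And>x. \<rho> x \<ge> 0" and \<rho>s: "\<And>x. norm x > \<epsilon> \<Longrightarrow> \<rho> x = 0"
    and \<rho>1: "(LINT x|lborel. \<rho> x) = 1"
    using \<rho> unfolding mollifier_def by auto
  have [measurable]: "\<rho> \<in> borel_measurable borel" using borel_measurable_continuous_onI[OF c] .
  have \<rho>i: "integrable lborel \<rho>" by (rule integrable_continuous_compact[OF c \<rho>s])
  have "(\<integral>\<^sup>+x. ennreal ((f x)\<^sup>2) * indicator (cball 0 r) x \<partial>lborel) < \<infinity>" for r
    by (rule le_less_trans[OF nn_integral_mono fin]) (auto simp: indicator_def)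
  then have floc: "loc_integrable f" by (intro loc_integrable_L2) auto
  have *: "conv f \<rho> x - f x = (LINT z|lborel. \<rho> z * (f (x - z) - f x))" for x
  proof -
    have "integrable lborel (\<lambda>z. \<rho> z * f (x - z))"
    proof -
      have i: "integrable lborel (\<lambda>y. f y * \<rho> (x - y))" by (rule conv_integrable[OF floc c \<rho>s])
      have "(\<integral>\<^sup>+y. ennreal (norm (\<rho> y * f (x - y))) \<partial>lborel) = (\<integral>\<^sup>+y. ennreal (norm (f y * \<rho> (x - y))) \<partial>lborel)"
        using nn_integral_lborel_reflect[of "\<lambda>y. ennreal (norm (\<rho> y * f (x - y)))" x]
        by (simp add: mult.commute)
      with i show ?thesis by (simp add: integrable_iff_bounded)
    qed
    then have "(LINT z|lborel. \<rho> z * f (x - z) - \<rho> z * f x) = conv f \<rho> x - f x"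
      using \<rho>i \<rho>1 by (simp add: conv_flip)
    then show ?thesis by (simp add: algebra_simps)
  qed
  have "(\<integral>\<^sup>+x. ennreal ((conv f \<rho> x - f x)\<^sup>2) \<partial>lborel)
      \<le> (\<integral>\<^sup>+x. (\<integral>\<^sup>+z. ennreal (\<rho> z * (f (x - z) - f x)\<^sup>2) \<partial>lborel) \<partial>lborel)"
    unfolding * by (intro nn_integral_mono jensen_square \<rho>i \<rho>0 \<rho>1) simp
  also have "\<dots> = (\<integral>\<^sup>+z. (\<integral>\<^sup>+x. ennreal (\<rho> z * (f (x - z) - f x)\<^sup>2) \<partial>lborel) \<partial>lborel)"
    by (rule lborel_pair.Fubini') simp
  also have "\<dots> = (\<integral>\<^sup>+z. ennreal (\<rho> z) * (\<integral>\<^sup>+x. ennreal ((f (x - z) - f x)\<^sup>2) \<partial>lborel) \<partial>lborel)"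
    using \<rho>0 by (intro nn_integral_cong) (simp add: ennreal_mult nn_integral_cmult)
  also have "\<dots> \<le> (\<integral>\<^sup>+z. ennreal (\<rho> z) * ennreal \<delta> \<partial>lborel)"
  proof (intro nn_integral_mono)
    fix z
    show "ennreal (\<rho> z) * (\<integral>\<^sup>+x. ennreal ((f (x - z) - f x)\<^sup>2) \<partial>lborel) \<le> ennreal (\<rho> z) * ennreal \<delta>"
      using tr[of z] \<rho>s[of z] by (cases "norm z \<le> \<epsilon>") (auto intro!: mult_left_mono)
  qed
  also have "\<dots> = ennreal \<delta>"
    using nn_integral_eq_integral[OF \<rho>i] \<rho>0 \<rho>1 by (simp add: nn_integral_multc)
  finally show ?thesis .
qed

lemma mollifier_mono: "mollifier \<epsilon> \<rho> \<Longrightarrow> \<epsilon> \<le> \<epsilon>' \<Longrightarrow> mollifier \<epsilon>' \<rho>"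
  unfolding mollifier_def by auto

text \<open>Since \<epsilon> \<le> 1, convolution on the ball of radius \<open>R\<close> sees
  \<open>f\<close> only up to radius \<open>R + 1\<close>, so \<open>f\<close> can be cut off there.
  The choice of \<epsilon> does not depend on the kernel, which later allows one sequence of kernels
  for all functions involved.\<close>

lemma mollifier_L2_local:
  fixes f :: "'a::euclidean_space \<Rightarrow> real"
  assumes f[measurable]: "f \<in> borel_measurable borel"
    and fin: "\<And>r. (\<integral>\<^sup>+x. ennreal ((f x)\<^sup>2) * indicator (cball 0 r) x \<partial>lborel) < \<infinity>"
    and \<delta>: "\<delta> > 0"
  obtains \<epsilon> where "\<epsilon> > 0" "\<And>\<rho>. mollifier \<epsilon> \<rho> \<Longrightarrow>
     (\<integral>\<^sup>+x. ennreal ((conv f \<rho> x - f x)\<^sup>2) * indicator (cball 0 R) x \<partial>lborel) \<le> ennreal \<delta>"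
proof -
  define F where "F x = indicat_real (cball 0 (R + 1)) x * f x" for x
  have F[measurable]: "F \<in> borel_measurable borel" unfolding F_def
    by (intro borel_measurable_times borel_measurable_indicator f) auto
  have "(\<integral>\<^sup>+x. ennreal ((F x)\<^sup>2) \<partial>lborel) = (\<integral>\<^sup>+x. ennreal ((f x)\<^sup>2) * indicator (cball 0 (R + 1)) x \<partial>lborel)"
    unfolding F_def by (intro nn_integral_cong) (auto simp: indicator_def)
  then have Ffin: "(\<integral>\<^sup>+x. ennreal ((F x)\<^sup>2) \<partial>lborel) < \<infinity>" using fin by simp
  have "\<And>x. norm x > R + 1 \<Longrightarrow> F x = 0" unfolding F_def by simp
  from L2_translation_continuous[OF F Ffin this \<delta>] obtain e where e: "e > 0"
    "\<And>z. norm z \<le> e \<Longrightarrow> (\<integral>\<^sup>+x. ennreal ((F (x - z) - F x)\<^sup>2) \<partial>lborel) \<le> ennreal \<delta>" by metis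
  define \<epsilon> where "\<epsilon> = min 1 e"
  have "(\<integral>\<^sup>+x. ennreal ((conv f \<rho> x - f x)\<^sup>2) * indicator (cball 0 R) x \<partial>lborel) \<le> ennreal \<delta>"
    if \<rho>: "mollifier \<epsilon> \<rho>" for \<rho>
  proof -
    have eq: "conv f \<rho> x = conv F \<rho> x" "f x = F x" if "norm x \<le> R" for x
    proof -
      have "f y * \<rho> (x - y) = F y * \<rho> (x - y)" for y
      proof (cases "norm y \<le> R + 1")
        case False
        then have "norm (x - y) > 1" using that norm_triangle_ineq2[of y x] by (simp add: norm_minus_commute)
        then show ?thesis using \<rho> unfolding mollifier_def \<epsilon>_def by simp
      qed (simp add: F_def)
      then show "conv f \<rho> x = conv F \<rho> x" by (simp only: conv_def)
      show "f x = F x" using that unfolding F_def by simp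
    qed
    have "(\<integral>\<^sup>+x. ennreal ((conv f \<rho> x - f x)\<^sup>2) * indicator (cball 0 R) x \<partial>lborel)
        \<le> (\<integral>\<^sup>+x. ennreal ((conv F \<rho> x - F x)\<^sup>2) \<partial>lborel)"
      by (intro nn_integral_mono) (auto simp: indicator_def eq)
    also have "\<dots> \<le> ennreal \<delta>"
      by (rule mollifier_L2_global[OF F Ffin \<rho> e(2)]) (simp add: \<epsilon>_def)
    finally show ?thesis .
  qed
  moreover have "\<epsilon> > 0" unfolding \<epsilon>_def using e(1) by simp
  ultimately show ?thesis using that by blast
qed

section \<open>The divergence of the stress-energy tensor\<close>

lemma C_k_vec_nth: "C_k k (u :: real^'n::finite \<Rightarrow> real^'m::finite) \<Longrightarrow> C_k k (\<lambda>y. u y $ l)"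
proof (induction k arbitrary: u)
  case 0
  then show ?case by (simp add: continuous_on_component)
next
  case (Suc k)
  then have d: "\<And>x. u differentiable (at x)" by auto
  have "partial_deriv j (\<lambda>y. u y $ l) = (\<lambda>y. partial_deriv j u y $ l)" for j
    using partial_deriv_vec_nth[OF d] by blast
  moreover have "C_k k (\<lambda>y. partial_deriv j u y $ l)" for j
    using Suc.prems by (intro Suc.IH) simp
  ultimately show ?case
    using differentiable_vec_nth[OF d] by simp
qed

lemma has_derivative_gradient:
  fixes W :: "real^'n::finite \<Rightarrow> real"
  assumes "W differentiable (at p)"
  shows "(W has_derivative (\<lambda>h. gradient W p \<bullet> h)) (at p)"
proof -
  let ?W' = "frechet_derivative W (at p)"
  have d: "(W has_derivative ?W') (at p)" using assms frechet_derivative_works by blast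
  then have lin: "linear ?W'" by (rule has_derivative_linear)
  have "?W' h = gradient W p \<bullet> h" for h
  proof -
    have "?W' h = ?W' (\<Sum>i\<in>UNIV. h $ i *\<^sub>R axis i 1)"
      using basis_expansion[of h] by (simp add: scalar_mult_eq_scaleR)
    also have "\<dots> = (\<Sum>i\<in>UNIV. h $ i * ?W' (axis i 1))"
      using lin by (simp add: linear_sum linear_scale)
    finally show ?thesis by (simp add: inner_vec_def gradient_def partial_deriv_def mult.commute)
  qed
  then have "?W' = (\<lambda>h. gradient W p \<bullet> h)" by blast
  with d show ?thesis by simp
qed

text \<open>The outer function is totally differentiable, but the inner one merely has partial
  derivatives: along a coordinate line \<open>v\<close> is a curve, and a curve is differentiable as
  soon as its components are.\<close>

lemma has_pderiv_chain:
  fixes W :: "real^'m::finite \<Rightarrow> real" and v :: "real^'n::finite \<Rightarrow> real^'m"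
  assumes W: "W differentiable (at (v x))" and v: "\<And>l. has_pderiv j (\<lambda>y. v y $ l) (d l) x"
  shows "has_pderiv j (\<lambda>y. W (v y)) (\<Sum>l\<in>UNIV. gradient W (v x) $ l * d l) x"
proof -
  let ?c = "\<lambda>t. v (x + t *\<^sub>R axis j 1)"
  have "(?c has_derivative (\<lambda>t. t *\<^sub>R (\<chi> l. d l))) (at 0)"
  proof (subst has_derivative_componentwise_within, rule ballI)
    fix b :: "real^'m" assume "b \<in> Basis"
    then obtain l where b: "b = axis l 1" by (auto simp: Basis_vec_def)
    have "(\<lambda>t. t * d l) = (*) (d l)" by (simp add: fun_eq_iff)
    then show "((\<lambda>t. ?c t \<bullet> b) has_derivative (\<lambda>t. t *\<^sub>R (\<chi> l. d l) \<bullet> b)) (at 0)"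
      using v[of l] by (simp add: b inner_axis has_pderiv_def has_field_derivative_def)
  qed
  from has_derivative_compose[OF this, of W "\<lambda>h. gradient W (v x) \<bullet> h"] W
  have "((\<lambda>t. W (?c t)) has_derivative (\<lambda>t. gradient W (v x) \<bullet> (t *\<^sub>R (\<chi> l. d l)))) (at 0)"
    by (simp add: has_derivative_gradient)
  moreover have "(\<lambda>t. gradient W (v x) \<bullet> (t *\<^sub>R (\<chi> l. d l))) = (*) (\<Sum>l\<in>UNIV. gradient W (v x) $ l * d l)"
    by (simp add: fun_eq_iff inner_vec_def sum_distrib_left mult_ac)
  ultimately show ?thesis unfolding has_pderiv_def has_field_derivative_def by simp
qed

text \<open>In matrix form the tensor is \<open>G\<close>^T \<open>G\<close> - (1/2 |G|^2 + W) I,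
  because half of the i-th squared column minus half of the others is the full i-th square minus
  half of the total. Diagonal and off-diagonal entries can then be differentiated together.\<close>

lemma stress_energy_nth:
  "stress_energy W p G $ i $ j = (\<Sum>l\<in>UNIV. G $ l $ i * G $ l $ j)
     - (if i = j then 1/2 * (\<Sum>k\<in>UNIV. \<Sum>l\<in>UNIV. G $ l $ k * G $ l $ k) + W p else 0)"
proof -
  have n: "(norm (column k G))\<^sup>2 = (\<Sum>l\<in>UNIV. G $ l $ k * G $ l $ k)" for k
    unfolding power2_norm_eq_inner by (simp add: inner_vec_def column_def)
  have "(\<Sum>k\<in>UNIV. (norm (column k G))\<^sup>2) = (norm (column i G))\<^sup>2 + (\<Sum>k\<in>UNIV - {i}. (norm (column k G))\<^sup>2)"
    by (rule sum.remove) auto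
  then show ?thesis
    by (simp add: stress_energy_def n) (simp add: column_def inner_vec_def algebra_simps)
qed

text \<open>\<open>w\<close>, \<open>P\<close> and \<open>Q l i j\<close> stand for \<open>W\<^sub>u(v)\<close>, \<open>\<nabla>v\<close> and the second derivatives of \<open>v\<^sub>l\<close>.\<close>

definition stress_energy_pderiv ::
    "real^'n::finite \<Rightarrow> real^'n^'n \<Rightarrow> ('n \<Rightarrow> 'n \<Rightarrow> 'n \<Rightarrow> real) \<Rightarrow> 'n \<Rightarrow> 'n \<Rightarrow> real" where
  "stress_energy_pderiv w P Q i j = (\<Sum>l\<in>UNIV. Q l i j * P $ l $ j + Q l j j * P $ l $ i)
     - (if i = j then (\<Sum>k\<in>UNIV. \<Sum>l\<in>UNIV. Q l k j * P $ l $ k) + (\<Sum>l\<in>UNIV. w $ l * P $ l $ j) else 0)"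

lemma has_pderiv_stress_energy:
  fixes v :: "real^'n::finite \<Rightarrow> real^'n"
  assumes v: "\<And>l. has_pderiv j (\<lambda>y. v y $ l) (P x $ l $ j) x"
    and P: "\<And>l i. has_pderiv j (\<lambda>y. P y $ l $ i) (Q l i j) x"
    and W: "W differentiable (at (v x))"
  shows "has_pderiv j (\<lambda>y. stress_energy W (v y) (P y) $ i $ j)
     (stress_energy_pderiv (gradient W (v x)) (P x) Q i j) x"
proof -
  note Wv = has_pderiv_chain[OF W v]
  have PP: "has_pderiv j (\<lambda>y. \<Sum>l\<in>UNIV. P y $ l $ i * P y $ l $ j)
      (\<Sum>l\<in>UNIV. Q l i j * P x $ l $ j + Q l j j * P x $ l $ i) x"
    by (intro has_pderiv_sum has_pderiv_mult P)
  have "has_pderiv j (\<lambda>y. 1/2 * (\<Sum>k\<in>UNIV. \<Sum>l\<in>UNIV. P y $ l $ k * P y $ l $ k))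
      (1/2 * (\<Sum>k\<in>UNIV. \<Sum>l\<in>UNIV. Q l k j * P x $ l $ k + Q l k j * P x $ l $ k)) x"
    by (intro has_pderiv_cmult has_pderiv_sum has_pderiv_mult P)
  moreover have "1/2 * (\<Sum>k\<in>UNIV. \<Sum>l\<in>UNIV. Q l k j * P x $ l $ k + Q l k j * P x $ l $ k)
      = (\<Sum>k\<in>UNIV. \<Sum>l\<in>UNIV. Q l k j * P x $ l $ k)"
    unfolding sum.distrib by simp
  ultimately have N: "has_pderiv j (\<lambda>y. 1/2 * (\<Sum>k\<in>UNIV. \<Sum>l\<in>UNIV. P y $ l $ k * P y $ l $ k))
      (\<Sum>k\<in>UNIV. \<Sum>l\<in>UNIV. Q l k j * P x $ l $ k) x"
    by (simp only:)
  show ?thesis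
    unfolding stress_energy_nth stress_energy_pderiv_def
    using has_pderiv_diff[OF PP has_pderiv_add[OF N Wv]] PP by auto
qed

text \<open>The derivative of the products yields a Laplacian term and the sum of
  \<open>Q l i j * P $ l $ j\<close>. By symmetry of \<open>Q\<close> the latter is the derivative
  of 1/2 |P|^2 in direction \<open>i\<close> and cancels against it, leaving \<open>P\<close>^T
  applied to the Laplacian minus \<open>w\<close>.\<close>

lemma sum_stress_energy_pderiv:
  assumes "\<And>l i j. Q l i j = Q l j i"
  shows "(\<Sum>j\<in>UNIV. stress_energy_pderiv w P Q i j)
     = (\<Sum>l\<in>UNIV. P $ l $ i * ((\<Sum>j\<in>UNIV. Q l j j) - w $ l))"
proof -
  have "(\<Sum>j\<in>UNIV. stress_energy_pderiv w P Q i j)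
      = (\<Sum>j\<in>UNIV. \<Sum>l\<in>UNIV. Q l i j * P $ l $ j) + (\<Sum>j\<in>UNIV. \<Sum>l\<in>UNIV. Q l j j * P $ l $ i)
        - (\<Sum>k\<in>UNIV. \<Sum>l\<in>UNIV. Q l k i * P $ l $ k) - (\<Sum>l\<in>UNIV. w $ l * P $ l $ i)"
    unfolding stress_energy_pderiv_def by (simp add: sum_subtractf sum.distrib)
  also have "(\<Sum>k\<in>UNIV. \<Sum>l\<in>UNIV. Q l k i * P $ l $ k) = (\<Sum>j\<in>UNIV. \<Sum>l\<in>UNIV. Q l i j * P $ l $ j)"
    by (intro sum.cong refl arg_cong2[where f="(*)"] assms)
  also have "(\<Sum>j\<in>UNIV. \<Sum>l\<in>UNIV. Q l j j * P $ l $ i) = (\<Sum>l\<in>UNIV. P $ l $ i * (\<Sum>j\<in>UNIV. Q l j j))"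
    by (subst sum.swap) (simp add: sum_distrib_left mult.commute)
  finally show ?thesis
    by (simp add: right_diff_distrib sum_subtractf mult.commute)
qed

lemma divergence_free_imp_elliptic:
  fixes u :: "real^'n::finite \<Rightarrow> real^'n"
  assumes W: "\<And>p. W differentiable (at p)" and u: "C_k 2 u"
    and div: "row_div (\<lambda>y. stress_energy W (u y) (jacobian u (at y))) x = 0"
    and det: "det (jacobian u (at x)) \<noteq> 0"
  shows "laplacian u x - gradient W (u x) = 0"
proof -
  let ?P = "\<lambda>y. jacobian u (at y)"
  define Q where "Q l i j = partial_deriv j (partial_deriv i (\<lambda>y. u y $ l)) x" for l i j
  have du: "\<And>y. u differentiable (at y)" and ddu: "\<And>j y. partial_deriv j u differentiable (at y)"
    using u unfolding numeral_2_eq_2 by simp_all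
  have comp: "partial_deriv j (\<lambda>y. u y $ l) = (\<lambda>y. partial_deriv j u y $ l)" for l j
    using partial_deriv_vec_nth[OF du] by blast
  have P: "?P y $ l $ j = partial_deriv j (\<lambda>y. u y $ l) y" for y l j
    unfolding comp by (simp add: jacobian_def matrix_def partial_deriv_def)
  have dP: "(\<lambda>y. ?P y $ l $ j) differentiable (at y)" for l j y
    unfolding P comp by (rule differentiable_vec_nth[OF ddu])
  have hu: "has_pderiv j (\<lambda>y. u y $ l) (?P x $ l $ j) x" for j l
    unfolding P by (intro differentiable_imp_has_pderiv differentiable_vec_nth du)
  have hP: "has_pderiv j (\<lambda>y. ?P y $ l $ i) (Q l i j) x" for j l i
    using differentiable_imp_has_pderiv[OF dP] unfolding P Q_def by blast
  have sym: "Q l i j = Q l j i" for l i j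
    unfolding Q_def by (rule C_2_partial_deriv_commute[OF C_k_vec_nth[OF u]])
  \<comment> \<open>\<open>row_div\<close> is built on the Frechet derivative, whose value is
    unspecified where a function is not differentiable. Total differentiability of the entries is
    what ties it to the derivative along lines.\<close>
  have dT: "(\<lambda>y. stress_energy W (u y) (?P y) $ i $ j) differentiable (at x)" for i j
  proof -
    have "(\<lambda>y. W (u y)) differentiable (at x)"
      using differentiable_compose[OF W du] .
    moreover have "(\<lambda>y. \<Sum>l\<in>UNIV. ?P y $ l $ i * ?P y $ l $ j) differentiable (at x)" for i j
      by (intro differentiable_sum ballI differentiable_mult dP) simp
    moreover have "(\<lambda>y. 1/2 * (\<Sum>k\<in>UNIV. \<Sum>l\<in>UNIV. ?P y $ l $ k * ?P y $ l $ k)) differentiable (at x)"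
      by (intro differentiable_mult differentiable_const differentiable_sum ballI dP) simp_all
    ultimately show ?thesis
      unfolding stress_energy_nth
      by (cases "i = j") (simp_all only: if_True if_False refl differentiable_diff differentiable_add differentiable_const)
  qed
  define e where "e = laplacian u x - gradient W (u x)"
  have e: "e $ l = (\<Sum>j\<in>UNIV. Q l j j) - gradient W (u x) $ l" for l
    unfolding e_def Q_def laplacian_def comp by (simp add: partial_deriv_vec_nth[OF ddu])
  have "(transpose (?P x) *v e) $ i = 0" for i
  proof -
    have "partial_deriv j (\<lambda>y. stress_energy W (u y) (?P y) $ i $ j) x
        = stress_energy_pderiv (gradient W (u x)) (?P x) Q i j" for j
      by (rule has_pderiv_unique[OF differentiable_imp_has_pderiv[OF dT] has_pderiv_stress_energy])
        (intro hu hP W)+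
    then have "row_div (\<lambda>y. stress_energy W (u y) (?P y)) x $ i
        = (\<Sum>j\<in>UNIV. stress_energy_pderiv (gradient W (u x)) (?P x) Q i j)"
      unfolding row_div_def by simp
    then show ?thesis
      using div by (simp add: sum_stress_energy_pderiv[OF sym] e matrix_vector_mult_def transpose_def)
  qed
  then have "transpose (?P x) *v e = 0" by (simp add: vec_eq_iff)
  have "invertible (transpose (?P x))" using det by (simp add: invertible_det_nz)
  then obtain B where "B ** transpose (?P x) = mat 1" unfolding invertible_def by blast
  then have "e = B *v (transpose (?P x) *v e)"
    by (simp only: matrix_vector_mul_assoc matrix_vector_mul_lid)
  with \<open>transpose (?P x) *v e = 0\<close> have "e = 0" by (simp del: transpose_matrix_vector)
  then show ?thesis unfolding e_def .
qed

section \<open>Mollified weak solutions\<close>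

text \<open>A bump function need not be constructed: the statement being proved for a test function
  \<open>\<phi>\<close> is trivial when \<open>\<phi> = 0\<close>, and otherwise rescaled and normalised squares of \<open>\<phi>\<close> are mollifiers.\<close>

lemma smooth_mollifier_exists:
  fixes \<phi> :: "real^'n::finite \<Rightarrow> real"
  assumes \<phi>: "test_function \<phi>" "\<phi> x0 \<noteq> 0" and \<epsilon>: "\<epsilon> > 0"
  obtains \<rho> :: "real^'n \<Rightarrow> real" where "test_function \<rho>" "mollifier \<epsilon> \<rho>"
proof -
  obtain r where s: "smooth \<phi>" and r: "\<And>x. norm x > r \<Longrightarrow> \<phi> x = 0"
    using \<phi> unfolding test_function_iff by blast
  \<comment> \<open>With this factor, norm x > \<epsilon> forces norm (c x) > r, so rescaling
    shrinks the support into radius \<epsilon>; the maximum with 1 keeps \<open>c\<close>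
    positive.\<close>
  define c where "c = max r 1 / \<epsilon>"
  have c: "c > 0" "c * \<epsilon> = max r 1" unfolding c_def using \<epsilon> by auto
  define \<psi> where "\<psi> x = \<phi> (c *\<^sub>R x + 0) * \<phi> (c *\<^sub>R x + 0)" for x
  have \<psi>s: "smooth \<psi>" unfolding \<psi>_def by (intro smooth_mult smooth_affine s)
  have cont: "continuous_on UNIV \<psi>" by (rule smooth_continuous[OF \<psi>s])
  have \<psi>0: "\<psi> x = 0" if "norm x > \<epsilon>" for x
  proof -
    have "norm (c *\<^sub>R x) > c * \<epsilon>" using that c(1) by simp
    then show ?thesis using r c(2) unfolding \<psi>_def by simp
  qed
  have int: "integrable lborel \<psi>" by (rule integrable_continuous_compact[OF cont \<psi>0])
  have nn: "\<psi> x \<ge> 0" for x unfolding \<psi>_def by simp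
  define I where "I = (LINT x|lborel. \<psi> x)"
  \<comment> \<open>A nonnegative function with integral 0 vanishes a.e., but the set where the
    continuous \<psi> is nonzero is open and contains the rescaled \<open>x0\<close>.\<close>
  have "I \<noteq> 0"
  proof
    assume "I = 0"
    then have "AE x in lborel. \<psi> x = 0"
      unfolding I_def using integral_nonneg_eq_0_iff_AE[OF int] nn by simp
    then have "{x. \<psi> x \<noteq> 0} \<in> null_sets lborel"
      by (subst (asm) AE_iff_null) (use borel_measurable_continuous_onI[OF cont] in auto)
    then have "negligible {x. \<psi> x \<noteq> 0}"
      by (simp add: negligible_iff_null_sets null_sets_completionI)
    moreover have "open {x. \<psi> x \<noteq> 0}"
      by (rule open_Collect_neq[OF cont continuous_on_const])
    moreover have "\<psi> (x0 /\<^sub>R c) \<noteq> 0" using \<phi>(2) c(1) unfolding \<psi>_def by simp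
    ultimately show False using open_not_negligible by blast
  qed
  moreover have "I \<ge> 0" unfolding I_def using nn by (intro integral_nonneg_AE AE_I2)
  ultimately have I: "I > 0" by simp
  define \<rho> where "\<rho> x = inverse I * \<psi> x" for x
  have "smooth \<rho>" unfolding \<rho>_def by (rule smooth_cmult[OF \<psi>s])
  then have "test_function \<rho>" unfolding test_function_iff \<rho>_def using \<psi>0 by auto
  moreover have "mollifier \<epsilon> \<rho>"
    unfolding mollifier_def
  proof (intro conjI allI impI)
    show "continuous_on UNIV \<rho>" by (rule smooth_continuous) fact
    show "\<rho> x \<ge> 0" for x unfolding \<rho>_def using I nn by simp
    show "\<rho> x = 0" if "norm x > \<epsilon>" for x unfolding \<rho>_def using \<psi>0[OF that] by simp
    show "(LINT x|lborel. \<rho> x) = 1" unfolding \<rho>_def using I by (simp add: I_def)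
  qed
  ultimately show ?thesis by (rule that)
qed

text \<open>The weak identity is tested with the reflected kernel
  \<open>\<lambda>y. \<rho> (x - y)\<close>. The sign from differentiating the reflection cancels
  the minus sign of the definition.\<close>

lemma conv_weak_derivative:
  fixes f g :: "real^'n::finite \<Rightarrow> real"
  assumes weak: "\<And>\<phi>. test_function \<phi> \<Longrightarrow>
      (LINT x|lborel. f x * partial_deriv j \<phi> x) = - (LINT x|lborel. g x * \<phi> x)"
    and \<rho>: "test_function \<rho>"
  shows "conv f (partial_deriv j \<rho>) x = conv g \<rho> x"
  using weak[OF test_function_reflect[OF \<rho>, of x]]
  by (simp add: partial_deriv_reflect[OF \<rho>] conv_def)

lemma test_functionE:
  assumes "test_function \<rho>"
  obtains r where "continuous_on UNIV \<rho>" "\<And>x. norm x > r \<Longrightarrow> \<rho> x = 0"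
  using assms smooth_continuous unfolding test_function_iff by blast

lemma has_pderiv_conv_test_function:
  fixes f \<rho> :: "real^'n::finite \<Rightarrow> real"
  assumes "loc_integrable f" "test_function \<rho>"
  shows "has_pderiv j (conv f \<rho>) (conv f (partial_deriv j \<rho>) x) x"
proof -
  from assms(2) obtain r where r: "continuous_on UNIV \<rho>" "\<And>x. norm x > r \<Longrightarrow> \<rho> x = 0"
    by (rule test_functionE) blast
  have "continuous_on UNIV (partial_deriv j \<rho>)"
    using test_function_partial_deriv[OF assms(2), of j] by (rule test_functionE)
  with r show ?thesis
    by (intro has_pderiv_conv[OF assms(1)] has_pderiv_test_function assms(2)) auto
qed

lemma continuous_on_conv_test_function:
  "loc_integrable f \<Longrightarrow> test_function \<rho> \<Longrightarrow> continuous_on UNIV (conv f \<rho>)"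
  by (erule test_functionE) (rule continuous_on_conv)

text \<open>Each product of \<open>S j\<close> with \<phi> has compact support, so its j-th
  derivative integrates to 0; the product rule separates the two terms.\<close>

lemma integral_by_parts_divergence:
  fixes S D :: "'n::finite \<Rightarrow> real^'n \<Rightarrow> real"
  assumes S: "\<And>j x. has_pderiv j (S j) (D j x) x" "\<And>j. continuous_on UNIV (S j)" "\<And>j. continuous_on UNIV (D j)"
    and \<phi>: "test_function \<phi>"
  shows "(LINT x|lborel. (\<Sum>j\<in>UNIV. S j x * partial_deriv j \<phi> x)) = - (LINT x|lborel. (\<Sum>j\<in>UNIV. D j x) * \<phi> x)"
proof -
  obtain r where r: "continuous_on UNIV \<phi>" "\<And>x. norm x > r \<Longrightarrow> \<phi> x = 0"
    using \<phi> by (rule test_functionE) blast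
  have c': "continuous_on UNIV (partial_deriv j \<phi>)" for j
    using test_function_partial_deriv[OF \<phi>, of j] by (rule test_functionE)
  have r': "partial_deriv j \<phi> x = 0" if "norm x > r" for j x
    using has_pderiv_eq_0[OF has_pderiv_test_function[OF \<phi>] r(2) that] .
  have i1: "integrable lborel (\<lambda>x. S j x * partial_deriv j \<phi> x)" for j
    by (rule integrable_continuous_compact[where s=r]) (intro continuous_on_mult S c', simp add: r')
  have i2: "integrable lborel (\<lambda>x. D j x * \<phi> x)" for j
    by (rule integrable_continuous_compact[where s=r]) (intro continuous_on_mult S r(1), simp add: r(2))
  have "(LINT x|lborel. S j x * partial_deriv j \<phi> x) = - (LINT x|lborel. D j x * \<phi> x)" for j
  proof -
    have "has_pderiv j (\<lambda>x. S j x * \<phi> x) (D j x * \<phi> x + partial_deriv j \<phi> x * S j x) x" for x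
      by (intro has_pderiv_mult S has_pderiv_test_function \<phi>)
    then have "(LINT x|lborel. D j x * \<phi> x + partial_deriv j \<phi> x * S j x) = 0"
      by (rule integral_has_pderiv_eq_0[where s=r])
        ((intro continuous_on_add continuous_on_mult S c' r(1))+, simp add: r(2))
    moreover have "(LINT x|lborel. D j x * \<phi> x + partial_deriv j \<phi> x * S j x)
        = (LINT x|lborel. D j x * \<phi> x) + (LINT x|lborel. S j x * partial_deriv j \<phi> x)"
      using i1 i2 by (simp add: mult.commute)
    ultimately show ?thesis by simp
  qed
  then show ?thesis
    using i1 i2 by (simp add: sum_distrib_right sum_negf)
qed

lemma continuous_on_gradient:
  fixes W :: "real^'n::finite \<Rightarrow> real"
  assumes "C_k 2 W"
  shows "continuous_on UNIV (gradient W)"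
proof -
  have "continuous_on UNIV (partial_deriv i W)" for i
    using assms unfolding numeral_2_eq_2 by (intro C_k_continuous[of 1]) simp
  then show ?thesis unfolding gradient_def by (intro continuous_on_vec_lambda)
qed

text \<open>Integration by parts is done with the continuous array \<open>Q\<close>. Only at the end
  is the trace of \<open>Q\<close> recognised as the convolution of \<open>F l\<close>, so the
  right-hand side of the equation enters solely through its tested form.\<close>

lemma mollified_stress_energy_identity:
  fixes U :: "'n::finite \<Rightarrow> real^'n \<Rightarrow> real" and DU :: "'n \<Rightarrow> 'n \<Rightarrow> real^'n \<Rightarrow> real"
  assumes W: "C_k 2 W"
    and loc: "\<And>l. loc_integrable (U l)" "\<And>l j. loc_integrable (DU l j)"
    and grad: "\<And>\<phi> l j. test_function \<phi> \<Longrightarrow>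
      (LINT x|lborel. U l x * partial_deriv j \<phi> x) = - (LINT x|lborel. DU l j x * \<phi> x)"
    and eq: "\<And>\<phi> l. test_function \<phi> \<Longrightarrow>
      (LINT x|lborel. (\<Sum>j\<in>UNIV. DU l j x * partial_deriv j \<phi> x)) = - (LINT x|lborel. F l x * \<phi> x)"
    and \<rho>: "test_function \<rho>" and \<phi>: "test_function \<phi>"
  defines "v \<equiv> \<lambda>x. \<chi> l. conv (U l) \<rho> x" and "P \<equiv> \<lambda>x. \<chi> l j. conv (DU l j) \<rho> x"
  shows "(LINT x|lborel. (\<Sum>j\<in>UNIV. stress_energy W (v x) (P x) $ i $ j * partial_deriv j \<phi> x))
     = - (LINT x|lborel. (\<Sum>l\<in>UNIV. P x $ l $ i * (conv (F l) \<rho> x - gradient W (v x) $ l)) * \<phi> x)"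
proof -
  define Q where "Q x l i j = conv (DU l i) (partial_deriv j \<rho>) x" for x l i j
  have Wd: "W differentiable (at p)" for p
    using W unfolding numeral_2_eq_2 by simp
  have \<rho>': "test_function (partial_deriv j \<rho>)" for j
    by (rule test_function_partial_deriv[OF \<rho>])
  have hv: "has_pderiv j (\<lambda>y. v y $ l) (P x $ l $ j) x" for j l x
    using has_pderiv_conv_test_function[OF loc(1) \<rho>, of j l x] conv_weak_derivative[of "U l" j "DU l j" \<rho> x, OF grad \<rho>]
    by (simp add: v_def P_def)
  have hP: "has_pderiv j (\<lambda>y. P y $ l $ i) (Q x l i j) x" for j l i x
    using has_pderiv_conv_test_function[OF loc(2) \<rho>, of j l i x] by (simp add: P_def Q_def)
  \<comment> \<open>Moving the remaining weak derivative onto \<rho> puts both derivatives on a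
    smooth kernel, where they commute. This is the source of the symmetry of
    \<open>Q\<close>.\<close>
  have Q: "Q x l i j = conv (U l) (partial_deriv i (partial_deriv j \<rho>)) x" for x l i j
    unfolding Q_def by (rule conv_weak_derivative[OF grad \<rho>', symmetric])
  have sym: "Q x l i j = Q x l j i" for x l i j
  proof -
    have "C_k 2 \<rho>" using \<rho> unfolding test_function_def smooth_def by blast
    then have "partial_deriv i (partial_deriv j \<rho>) = partial_deriv j (partial_deriv i \<rho>)"
      using C_2_partial_deriv_commute by blast
    then show ?thesis unfolding Q by simp
  qed
  have lap: "(\<Sum>j\<in>UNIV. Q x l j j) = conv (F l) \<rho> x" for x l
  proof -
    have i: "integrable lborel (\<lambda>y. DU l j y * partial_deriv j \<rho> (x - y))" for j
      using \<rho>'[of j] by (rule test_functionE) (rule conv_integrable[OF loc(2)])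
    have "(\<Sum>j\<in>UNIV. Q x l j j) = (LINT y|lborel. (\<Sum>j\<in>UNIV. DU l j y * partial_deriv j \<rho> (x - y)))"
      unfolding Q_def conv_def using i by simp
    also have "\<dots> = - (LINT y|lborel. (\<Sum>j\<in>UNIV. DU l j y * partial_deriv j (\<lambda>y. \<rho> (x - y)) y))"
      by (simp add: partial_deriv_reflect[OF \<rho>] sum_negf)
    also have "\<dots> = conv (F l) \<rho> x"
      using eq[OF test_function_reflect[OF \<rho>]] by (simp add: conv_def)
    finally show ?thesis .
  qed
  have cP: "continuous_on UNIV (\<lambda>x. P x $ l $ j)" for l j
    unfolding P_def by (simp add: continuous_on_conv_test_function[OF loc(2) \<rho>])
  have cQ: "continuous_on UNIV (\<lambda>x. Q x l i j)" for l i j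
    unfolding Q_def by (rule continuous_on_conv_test_function[OF loc(2) \<rho>'])
  have cv: "continuous_on UNIV v"
    unfolding v_def by (intro continuous_on_vec_lambda continuous_on_conv_test_function[OF loc(1) \<rho>])
  have cW: "continuous_on UNIV (\<lambda>x. W (v x))"
    by (rule continuous_on_compose2[OF C_k_continuous[OF W] cv]) simp
  have cg: "continuous_on UNIV (\<lambda>x. gradient W (v x) $ l)" for l
    by (intro continuous_on_component continuous_on_compose2[OF continuous_on_gradient[OF W] cv]) simp
  have cS: "continuous_on UNIV (\<lambda>x. stress_energy W (v x) (P x) $ i $ j)" for j
    unfolding stress_energy_nth
    by (cases "i = j"; simp only: if_True if_False refl)
      (intro continuous_on_diff continuous_on_add continuous_on_sum continuous_on_mult continuous_on_const cP cW)+
  have cD: "continuous_on UNIV (\<lambda>x. stress_energy_pderiv (gradient W (v x)) (P x) (Q x) i j)" for j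
    unfolding stress_energy_pderiv_def
    by (cases "i = j"; simp only: if_True if_False refl)
      (intro continuous_on_diff continuous_on_add continuous_on_sum continuous_on_mult continuous_on_const cP cQ cg)+
  have "(LINT x|lborel. (\<Sum>j\<in>UNIV. stress_energy W (v x) (P x) $ i $ j * partial_deriv j \<phi> x))
      = - (LINT x|lborel. (\<Sum>j\<in>UNIV. stress_energy_pderiv (gradient W (v x)) (P x) (Q x) i j) * \<phi> x)"
    by (rule integral_by_parts_divergence[OF has_pderiv_stress_energy[OF hv hP Wd] cS cD \<phi>])
  then show ?thesis
    by (simp only: sum_stress_energy_pderiv[OF sym] lap)
qed

section \<open>Convergence of products\<close>

definition L2_fun :: "'a measure \<Rightarrow> ('a \<Rightarrow> real) \<Rightarrow> bool" where
  "L2_fun M f \<longleftrightarrow> f \<in> borel_measurable M \<and> integrable M (\<lambda>x. (f x)\<^sup>2)"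

text \<open>Square integrability of every member is built in: the integral of a non-integrable
  function is 0 by convention, so the limit alone could hold vacuously.\<close>

definition L2_lim :: "'a measure \<Rightarrow> (nat \<Rightarrow> 'a \<Rightarrow> real) \<Rightarrow> ('a \<Rightarrow> real) \<Rightarrow> bool" where
  "L2_lim M F f \<longleftrightarrow> (\<forall>n. L2_fun M (F n)) \<and> L2_fun M f \<and> (\<lambda>n. LINT x|M. (F n x - f x)\<^sup>2) \<longlonglongrightarrow> 0"

definition L1_lim :: "'a measure \<Rightarrow> (nat \<Rightarrow> 'a \<Rightarrow> real) \<Rightarrow> ('a \<Rightarrow> real) \<Rightarrow> bool" where
  "L1_lim M F f \<longleftrightarrow> (\<forall>n. integrable M (F n)) \<and> integrable M f \<and> (\<lambda>n. LINT x|M. \<bar>F n x - f x\<bar>) \<longlonglongrightarrow> 0"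

lemma L2_fun_mult:
  assumes f: "L2_fun M f" and g: "L2_fun M g"
  shows "integrable M (\<lambda>x. f x * g x)"
proof (rule Bochner_Integration.integrable_bound)
  show "integrable M (\<lambda>x. (f x)\<^sup>2 + (g x)\<^sup>2)"
    using f g unfolding L2_fun_def by (intro Bochner_Integration.integrable_add) blast+
  show "AE x in M. norm (f x * g x) \<le> norm ((f x)\<^sup>2 + (g x)\<^sup>2)"
  proof (rule AE_I2)
    fix x
    have "2 * \<bar>f x * g x\<bar> \<le> (f x)\<^sup>2 + (g x)\<^sup>2"
      using zero_le_power2[of "\<bar>f x\<bar> - \<bar>g x\<bar>"] by (simp add: power2_diff abs_mult)
    then show "norm (f x * g x) \<le> norm ((f x)\<^sup>2 + (g x)\<^sup>2)"
      using abs_ge_zero[of "f x * g x"] unfolding real_norm_def by linarith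
  qed
  show "(\<lambda>x. f x * g x) \<in> borel_measurable M"
    using f g unfolding L2_fun_def by (intro borel_measurable_times) blast+
qed

lemma L2_fun_add:
  assumes f: "L2_fun M f" and g: "L2_fun M g"
  shows "L2_fun M (\<lambda>x. f x + g x)"
proof -
  have "integrable M (\<lambda>x. (f x)\<^sup>2 + (g x)\<^sup>2 + 2 * (f x * g x))"
    using f g unfolding L2_fun_def
    by (intro Bochner_Integration.integrable_add integrable_mult_right L2_fun_mult f g) blast+
  moreover have "(\<lambda>x. (f x + g x)\<^sup>2) = (\<lambda>x. (f x)\<^sup>2 + (g x)\<^sup>2 + 2 * (f x * g x))"
    by (simp add: fun_eq_iff power2_sum)
  moreover have "(\<lambda>x. f x + g x) \<in> borel_measurable M"
    using f g unfolding L2_fun_def by (intro borel_measurable_add) blast+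
  ultimately show ?thesis unfolding L2_fun_def by simp
qed

lemma L2_fun_diff:
  assumes f: "L2_fun M f" and g: "L2_fun M g"
  shows "L2_fun M (\<lambda>x. f x - g x)"
proof -
  have "L2_fun M (\<lambda>x. - g x)" using g unfolding L2_fun_def by simp
  from L2_fun_add[OF f this] show ?thesis by simp
qed

text \<open>The integral of (t|f| - |g|)^2 is a nonnegative quadratic in \<open>t\<close>;
  evaluation at its minimum \<open>C / A\<close> gives the inequality.\<close>

lemma Cauchy_Schwarz_integral:
  assumes f: "L2_fun M f" and g: "L2_fun M g"
  shows "(LINT x|M. \<bar>f x * g x\<bar>) \<le> sqrt (LINT x|M. (f x)\<^sup>2) * sqrt (LINT x|M. (g x)\<^sup>2)"
proof -
  define A B C where "A = (LINT x|M. (f x)\<^sup>2)" "B = (LINT x|M. (g x)\<^sup>2)" "C = (LINT x|M. \<bar>f x * g x\<bar>)"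
  have nn: "A \<ge> 0" "B \<ge> 0" "C \<ge> 0" unfolding A_B_C_def by (intro integral_nonneg_AE; simp)+
  have ineq: "0 \<le> t\<^sup>2 * A - 2 * t * C + B" for t
  proof -
    have i: "integrable M (\<lambda>x. \<bar>f x * g x\<bar>)" using L2_fun_mult[OF f g] by simp
    have "0 \<le> (LINT x|M. (t * \<bar>f x\<bar> - \<bar>g x\<bar>)\<^sup>2)" by (intro integral_nonneg_AE) simp
    also have "\<dots> = (LINT x|M. t\<^sup>2 * (f x)\<^sup>2 - 2 * t * \<bar>f x * g x\<bar> + (g x)\<^sup>2)"
      by (intro Bochner_Integration.integral_cong refl) (simp add: power2_diff power_mult_distrib abs_mult)
    also have "\<dots> = t\<^sup>2 * A - 2 * t * C + B"
      using f g i unfolding A_B_C_def L2_fun_def by simp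
    finally show ?thesis .
  qed
  have "C\<^sup>2 \<le> A * B"
  proof (cases "A = 0")
    case True
    have "C = 0"
    proof (rule ccontr)
      assume "C \<noteq> 0"
      with nn(3) have "C > 0" by simp
      \<comment> \<open>For \<open>A = 0\<close> the expression is affine in \<open>t\<close>, and
        this value of \<open>t\<close> makes it -1.\<close>
      then show False using ineq[of "(B + 1) / (2 * C)"] True by simp
    qed
    then show ?thesis using nn by simp
  next
    case False
    then have A: "A > 0" using nn by simp
    have "0 \<le> A * ((C / A)\<^sup>2 * A - 2 * (C / A) * C + B)" using ineq[of "C / A"] A by simp
    also have "\<dots> = A * B - C\<^sup>2" using A by (simp add: power2_eq_square field_simps)
    finally show ?thesis by simp
  qed
  then have "C \<le> sqrt (A * B)" by (rule real_le_rsqrt)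
  then show ?thesis unfolding A_B_C_def by (simp add: real_sqrt_mult)
qed

text \<open>FG - fg is split as (F - f)(G - g) + f(G - g) + (F - f)g. Besides the two errors only
  the norms of the fixed limits occur, so no uniform bound on the sequences has to be found
  first.\<close>

lemma L2_lim_mult:
  assumes F: "L2_lim M F f" and G: "L2_lim M G g"
  shows "L1_lim M (\<lambda>n x. F n x * G n x) (\<lambda>x. f x * g x)"
proof -
  have f: "L2_fun M f" "\<And>n. L2_fun M (F n)" "(\<lambda>n. LINT x|M. (F n x - f x)\<^sup>2) \<longlonglongrightarrow> 0"
    and g: "L2_fun M g" "\<And>n. L2_fun M (G n)" "(\<lambda>n. LINT x|M. (G n x - g x)\<^sup>2) \<longlonglongrightarrow> 0"
    using F G unfolding L2_lim_def by auto
  define p where "p n = (LINT x|M. (F n x - f x)\<^sup>2)" for n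
  define q where "q n = (LINT x|M. (G n x - g x)\<^sup>2)" for n
  define A where "A = (LINT x|M. (f x)\<^sup>2)"
  define B where "B = (LINT x|M. (g x)\<^sup>2)"
  have bound: "(LINT x|M. \<bar>F n x * G n x - f x * g x\<bar>)
      \<le> sqrt (p n) * sqrt (q n) + sqrt A * sqrt (q n) + sqrt (p n) * sqrt B" for n
  proof -
    note df = L2_fun_diff[OF f(2) f(1), of n] and dg = L2_fun_diff[OF g(2) g(1), of n]
    note i1 = integrable_abs[OF L2_fun_mult[OF df dg]] and i2 = integrable_abs[OF L2_fun_mult[OF f(1) dg]]
      and i3 = integrable_abs[OF L2_fun_mult[OF df g(1)]]
    have "(LINT x|M. \<bar>F n x * G n x - f x * g x\<bar>)
        \<le> (LINT x|M. \<bar>(F n x - f x) * (G n x - g x)\<bar> + \<bar>f x * (G n x - g x)\<bar> + \<bar>(F n x - f x) * g x\<bar>)"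
    proof (rule integral_mono)
      show "integrable M (\<lambda>x. \<bar>F n x * G n x - f x * g x\<bar>)"
        using L2_fun_mult[OF f(2) g(2)] L2_fun_mult[OF f(1) g(1)] by simp
      show "integrable M (\<lambda>x. \<bar>(F n x - f x) * (G n x - g x)\<bar> + \<bar>f x * (G n x - g x)\<bar> + \<bar>(F n x - f x) * g x\<bar>)"
        using i1 i2 i3 by (intro Bochner_Integration.integrable_add)
      have "F n x * G n x - f x * g x = (F n x - f x) * (G n x - g x) + f x * (G n x - g x) + (F n x - f x) * g x" for x
        by (simp add: algebra_simps)
      then show "\<bar>F n x * G n x - f x * g x\<bar>
          \<le> \<bar>(F n x - f x) * (G n x - g x)\<bar> + \<bar>f x * (G n x - g x)\<bar> + \<bar>(F n x - f x) * g x\<bar>" for x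
        by (smt (verit))
    qed
    also have "\<dots> = (LINT x|M. \<bar>(F n x - f x) * (G n x - g x)\<bar>) + (LINT x|M. \<bar>f x * (G n x - g x)\<bar>)
        + (LINT x|M. \<bar>(F n x - f x) * g x\<bar>)"
      using i1 i2 i3 by (simp only: Bochner_Integration.integral_add Bochner_Integration.integrable_add)
    also have "\<dots> \<le> sqrt (p n) * sqrt (q n) + sqrt A * sqrt (q n) + sqrt (p n) * sqrt B"
      unfolding p_def q_def A_def B_def
      by (intro add_mono Cauchy_Schwarz_integral df dg f g)
    finally show ?thesis .
  qed
  have "(\<lambda>n. sqrt (p n) * sqrt (q n) + sqrt A * sqrt (q n) + sqrt (p n) * sqrt B)
      \<longlonglongrightarrow> sqrt 0 * sqrt 0 + sqrt A * sqrt 0 + sqrt 0 * sqrt B"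
    by (intro tendsto_intros) (use f g in \<open>auto simp: p_def q_def\<close>)
  then have lim: "(\<lambda>n. sqrt (p n) * sqrt (q n) + sqrt A * sqrt (q n) + sqrt (p n) * sqrt B) \<longlonglongrightarrow> 0"
    by simp
  have "(\<lambda>n. LINT x|M. \<bar>F n x * G n x - f x * g x\<bar>) \<longlonglongrightarrow> 0"
  proof (rule real_tendsto_sandwich[OF _ _ tendsto_const lim])
    show "\<forall>\<^sub>F n in sequentially. 0 \<le> (LINT x|M. \<bar>F n x * G n x - f x * g x\<bar>)"
      by (intro always_eventually allI integral_nonneg_AE) simp
  qed (intro always_eventually allI bound)
  moreover have "integrable M (\<lambda>x. F n x * G n x)" for n by (rule L2_fun_mult[OF f(2) g(2)])
  moreover have "integrable M (\<lambda>x. f x * g x)" by (rule L2_fun_mult[OF f(1) g(1)])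
  ultimately show ?thesis unfolding L1_lim_def by blast
qed

text \<open>Meant for \<open>H n = h (v n)\<close> with Lipschitz \<open>h\<close>: the pointwise
  bound carries L2 convergence of the components of \<open>v n\<close> over to \<open>H n\<close>.
  Membership of \<open>H n\<close> in L2 follows by writing it as the limit plus the dominated
  error.\<close>

lemma L2_lim_dominated:
  fixes V :: "nat \<Rightarrow> 'i::finite \<Rightarrow> 'a \<Rightarrow> real"
  assumes V: "\<And>l. L2_lim M (\<lambda>n. V n l) (U l)" and H: "\<And>n. H n \<in> borel_measurable M" and h: "L2_fun M h"
    and dom: "\<And>n. AE x in M. (H n x - h x)\<^sup>2 \<le> L * (\<Sum>l\<in>UNIV. (V n l x - U l x)\<^sup>2)"
  shows "L2_lim M H h"
proof -
  have iV: "integrable M (\<lambda>x. (V n l x - U l x)\<^sup>2)" for n l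
    using L2_fun_diff[of M "V n l" "U l"] V[of l] unfolding L2_lim_def L2_fun_def by auto
  then have i: "integrable M (\<lambda>x. L * (\<Sum>l\<in>UNIV. (V n l x - U l x)\<^sup>2))" for n by auto
  have iH: "integrable M (\<lambda>x. (H n x - h x)\<^sup>2)" for n
    by (rule Bochner_Integration.integrable_bound[OF i[of n]])
      (use dom[of n] H[of n] h in \<open>auto simp: L2_fun_def\<close>)
  have "L2_fun M (\<lambda>x. h x + (H n x - h x))" for n
    by (rule L2_fun_add[OF h]) (use iH[of n] H[of n] h in \<open>auto simp: L2_fun_def\<close>)
  then have "L2_fun M (H n)" for n by simp
  moreover have "(\<lambda>n. LINT x|M. (H n x - h x)\<^sup>2) \<longlonglongrightarrow> 0"
  proof (rule real_tendsto_sandwich[OF _ _ tendsto_const])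
    show "\<forall>\<^sub>F n in sequentially. 0 \<le> (LINT x|M. (H n x - h x)\<^sup>2)"
      by (intro always_eventually allI integral_nonneg_AE) simp
    show "\<forall>\<^sub>F n in sequentially. (LINT x|M. (H n x - h x)\<^sup>2) \<le> L * (\<Sum>l\<in>UNIV. LINT x|M. (V n l x - U l x)\<^sup>2)"
    proof (intro always_eventually allI)
      fix n
      have "(LINT x|M. (H n x - h x)\<^sup>2) \<le> (LINT x|M. L * (\<Sum>l\<in>UNIV. (V n l x - U l x)\<^sup>2))"
        by (rule integral_mono_AE[OF iH i dom])
      then show "(LINT x|M. (H n x - h x)\<^sup>2) \<le> L * (\<Sum>l\<in>UNIV. LINT x|M. (V n l x - U l x)\<^sup>2)"
        using iV by simp
    qed
    have "(\<lambda>n. L * (\<Sum>l\<in>UNIV. LINT x|M. (V n l x - U l x)\<^sup>2)) \<longlonglongrightarrow> L * (\<Sum>l\<in>(UNIV::'i set). 0)"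
      by (intro tendsto_intros) (use V in \<open>auto simp: L2_lim_def\<close>)
    then show "(\<lambda>n. L * (\<Sum>l\<in>UNIV. LINT x|M. (V n l x - U l x)\<^sup>2)) \<longlonglongrightarrow> 0" by simp
  qed
  ultimately show ?thesis unfolding L2_lim_def using h by blast
qed

lemma L2_lim_const: "L2_fun M f \<Longrightarrow> L2_lim M (\<lambda>n. f) f"
  unfolding L2_lim_def by simp

text \<open>The two-sequence bound with a factor \<open>c\<close> is shaped to give sums and
  differences (\<open>c = 1\<close>) and products with a bounded function (\<open>G = 0\<close>)
  from one argument.\<close>

lemma L1_lim_dominated:
  assumes F: "L1_lim M F f" and h: "\<And>n. integrable M (H n)" "integrable M h"
    and G: "L1_lim M G g"
    and dom: "\<And>n x. \<bar>H n x - h x\<bar> \<le> c * \<bar>F n x - f x\<bar> + \<bar>G n x - g x\<bar>"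
  shows "L1_lim M H h"
proof -
  have i: "integrable M (\<lambda>x. c * \<bar>F n x - f x\<bar> + \<bar>G n x - g x\<bar>)" for n
    using F G unfolding L1_lim_def by simp
  have "(\<lambda>n. LINT x|M. \<bar>H n x - h x\<bar>) \<longlonglongrightarrow> 0"
  proof (rule real_tendsto_sandwich[OF _ _ tendsto_const])
    show "\<forall>\<^sub>F n in sequentially. 0 \<le> (LINT x|M. \<bar>H n x - h x\<bar>)"
      by (intro always_eventually allI integral_nonneg_AE) simp
    show "\<forall>\<^sub>F n in sequentially. (LINT x|M. \<bar>H n x - h x\<bar>)
        \<le> c * (LINT x|M. \<bar>F n x - f x\<bar>) + (LINT x|M. \<bar>G n x - g x\<bar>)"
    proof (intro always_eventually allI)
      fix n
      have "(LINT x|M. \<bar>H n x - h x\<bar>) \<le> (LINT x|M. c * \<bar>F n x - f x\<bar> + \<bar>G n x - g x\<bar>)"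
        by (rule integral_mono[OF _ i dom]) (use h in auto)
      then show "(LINT x|M. \<bar>H n x - h x\<bar>) \<le> c * (LINT x|M. \<bar>F n x - f x\<bar>) + (LINT x|M. \<bar>G n x - g x\<bar>)"
        using F G unfolding L1_lim_def by simp
    qed
    have "(\<lambda>n. c * (LINT x|M. \<bar>F n x - f x\<bar>) + (LINT x|M. \<bar>G n x - g x\<bar>)) \<longlonglongrightarrow> c * 0 + 0"
      by (intro tendsto_intros) (use F G in \<open>auto simp: L1_lim_def\<close>)
    then show "(\<lambda>n. c * (LINT x|M. \<bar>F n x - f x\<bar>) + (LINT x|M. \<bar>G n x - g x\<bar>)) \<longlonglongrightarrow> 0" by simp
  qed
  then show ?thesis unfolding L1_lim_def using h by blast
qed

lemma L1_lim_0: "L1_lim M (\<lambda>n x. 0) (\<lambda>x. 0)"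
  unfolding L1_lim_def by simp

lemma L1_lim_add:
  assumes "L1_lim M F f" "L1_lim M G g"
  shows "L1_lim M (\<lambda>n x. F n x + G n x) (\<lambda>x. f x + g x)"
  by (rule L1_lim_dominated[OF assms(1) _ _ assms(2), where c=1]) (use assms in \<open>auto simp: L1_lim_def\<close>)

lemma L1_lim_diff:
  assumes "L1_lim M F f" "L1_lim M G g"
  shows "L1_lim M (\<lambda>n x. F n x - G n x) (\<lambda>x. f x - g x)"
  by (rule L1_lim_dominated[OF assms(1) _ _ assms(2), where c=1]) (use assms in \<open>auto simp: L1_lim_def\<close>)

lemma L1_lim_sum:
  assumes "\<And>i. i \<in> I \<Longrightarrow> L1_lim M (F i) (f i)"
  shows "L1_lim M (\<lambda>n x. \<Sum>i\<in>I. F i n x) (\<lambda>x. \<Sum>i\<in>I. f i x)"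
  using assms
proof (induction I rule: infinite_finite_induct)
  case (insert i I)
  then have "L1_lim M (\<lambda>n x. F i n x + (\<Sum>i\<in>I. F i n x)) (\<lambda>x. f i x + (\<Sum>i\<in>I. f i x))"
    by (intro L1_lim_add) simp_all
  with insert show ?case by simp
qed (simp_all add: L1_lim_0)

lemma L1_lim_bounded_mult:
  assumes F: "L1_lim M F f" and c: "c \<in> borel_measurable M" "\<And>x. \<bar>c x\<bar> \<le> B"
  shows "L1_lim M (\<lambda>n x. F n x * c x) (\<lambda>x. f x * c x)"
proof (rule L1_lim_dominated[OF F _ _ L1_lim_0, where c=B])
  have i: "integrable M (\<lambda>x. g x * c x)" if "integrable M g" for g
  proof (rule Bochner_Integration.integrable_bound)
    show "integrable M (\<lambda>x. B * g x)" using that by simp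
    have "\<bar>g x\<bar> * \<bar>c x\<bar> \<le> \<bar>B\<bar> * \<bar>g x\<bar>" for x
      using mult_left_mono[OF order_trans[OF c(2)[of x] abs_ge_self], of "\<bar>g x\<bar>"] by (simp add: mult.commute)
    then show "AE x in M. norm (g x * c x) \<le> norm (B * g x)" by (simp add: abs_mult)
  qed (use that c in auto)
  show "integrable M (\<lambda>x. F n x * c x)" for n using F unfolding L1_lim_def by (intro i) blast
  show "integrable M (\<lambda>x. f x * c x)" using F unfolding L1_lim_def by (intro i) blast
  show "\<bar>F n x * c x - f x * c x\<bar> \<le> B * \<bar>F n x - f x\<bar> + \<bar>0 - 0\<bar>" for n x
    using mult_left_mono[OF c(2)[of x], of "\<bar>F n x - f x\<bar>"]
    unfolding left_diff_distrib[symmetric] abs_mult by (simp add: mult.commute)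
qed

lemma L1_lim_cmult: "L1_lim M F f \<Longrightarrow> L1_lim M (\<lambda>n x. c * F n x) (\<lambda>x. c * f x)"
  using L1_lim_bounded_mult[of M F f "\<lambda>x. c" "\<bar>c\<bar>"] by (simp add: mult.commute)

lemma L1_lim_integral:
  assumes "L1_lim M F f"
  shows "(\<lambda>n. LINT x|M. F n x) \<longlonglongrightarrow> (LINT x|M. f x)"
proof (rule LIM_zero_cancel, rule Lim_null_comparison)
  show "(\<lambda>n. LINT x|M. \<bar>F n x - f x\<bar>) \<longlonglongrightarrow> 0" using assms unfolding L1_lim_def by blast
  have "norm ((LINT x|M. F n x) - (LINT x|M. f x)) \<le> (LINT x|M. \<bar>F n x - f x\<bar>)" for n
    using integral_abs_bound[of M "\<lambda>x. F n x - f x"] assms unfolding L1_lim_def by simp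
  then show "\<forall>\<^sub>F n in sequentially. norm ((LINT x|M. F n x) - (LINT x|M. f x)) \<le> (LINT x|M. \<bar>F n x - f x\<bar>)"
    by simp
qed

section \<open>Lebesgue measure on a ball\<close>

text \<open>A density instead of a restricted space: the underlying space and sigma-algebra stay
  those of Borel sets, so measurability statements do not change with \<open>R\<close>.\<close>

definition ball_measure :: "real \<Rightarrow> 'a::euclidean_space measure" where
  "ball_measure R = density lborel (\<lambda>x. ennreal (indicat_real (cball 0 R) x))"

lemma measurable_ball_measure [simp]: "borel_measurable (ball_measure R) = borel_measurable borel"
  unfolding ball_measure_def by (simp add: measurable_def)

lemma measurable_indicat_cball [measurable]: "indicat_real (cball (a::'a::euclidean_space) R) \<in> borel_measurable borel"
  by (rule borel_measurable_indicator) simp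

lemma integrable_ball_measure:
  fixes f :: "'a::euclidean_space \<Rightarrow> real"
  assumes "f \<in> borel_measurable borel"
  shows "integrable (ball_measure R) f \<longleftrightarrow> set_integrable lborel (cball 0 R) f"
  unfolding ball_measure_def set_integrable_def using assms by (subst integrable_density) auto

lemma integral_ball_measure:
  fixes f :: "'a::euclidean_space \<Rightarrow> real"
  assumes "f \<in> borel_measurable borel" "\<And>x. norm x > R \<Longrightarrow> f x = 0"
  shows "(LINT x|ball_measure R. f x) = (LINT x|lborel. f x)"
proof -
  have "(LINT x|ball_measure R. f x) = (LINT x|lborel. indicat_real (cball 0 R) x *\<^sub>R f x)"
    unfolding ball_measure_def using assms(1) by (subst integral_density) auto
  also have "\<dots> = (LINT x|lborel. f x)"
    using assms(2) by (intro Bochner_Integration.integral_cong refl) (auto simp: indicator_def)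
  finally show ?thesis .
qed

lemma nn_integral_ball_measure:
  assumes "f \<in> borel_measurable borel"
  shows "(\<integral>\<^sup>+x. f x \<partial>ball_measure R) = (\<integral>\<^sup>+x. f x * indicator (cball 0 R) x \<partial>lborel)"
  unfolding ball_measure_def using assms
  by (subst nn_integral_density) (auto intro!: nn_integral_cong simp: indicator_def)

lemma AE_ball_measure:
  "(AE x in ball_measure R. P x) \<longleftrightarrow> (AE x in lborel. norm x \<le> R \<longrightarrow> P x)"
  unfolding ball_measure_def by (subst AE_density) (auto simp: indicator_def)

lemma L2_fun_bounded:
  fixes f :: "'a::euclidean_space \<Rightarrow> real"
  assumes f: "f \<in> borel_measurable borel" and b: "AE x in ball_measure R. \<bar>f x\<bar> \<le> B"
  shows "L2_fun (ball_measure R) f"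
proof -
  have "integrable (ball_measure R) (\<lambda>x::'a. B\<^sup>2)"
    using loc_integrable_const[of "B\<^sup>2", where 'a='a] unfolding loc_integrable_def
    by (subst integrable_ball_measure) auto
  then have "integrable (ball_measure R) (\<lambda>x. (f x)\<^sup>2)"
  proof (rule Bochner_Integration.integrable_bound)
    show "AE x in ball_measure R. norm ((f x)\<^sup>2) \<le> norm (B\<^sup>2)"
      using b
    proof eventually_elim
      fix x assume "\<bar>f x\<bar> \<le> B"
      from power_mono[OF this abs_ge_zero, of 2] show "norm ((f x)\<^sup>2) \<le> norm (B\<^sup>2)" by simp
    qed
  qed (use f in simp)
  with f show ?thesis unfolding L2_fun_def by simp
qed

lemma L2_fun_continuous:
  fixes f :: "'a::euclidean_space \<Rightarrow> real"
  assumes "continuous_on UNIV f"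
  shows "L2_fun (ball_measure R) f"
proof -
  have "compact (f ` cball 0 R)"
    using assms by (intro compact_continuous_image) (auto intro: continuous_on_subset)
  then obtain B where "\<forall>x\<in>cball 0 R. \<bar>f x\<bar> \<le> B"
    by (auto dest!: compact_imp_bounded simp: bounded_iff)
  then have "AE x in ball_measure R. \<bar>f x\<bar> \<le> B" by (simp add: AE_ball_measure)
  then show ?thesis by (rule L2_fun_bounded[OF borel_measurable_continuous_onI[OF assms]])
qed

text \<open>Translates between the extended integrals of the mollification estimates and the real
  integrals in \<open>L2_lim\<close>.\<close>

lemma L2_fun_nn_integral:
  fixes f :: "'a::euclidean_space \<Rightarrow> real"
  assumes "L2_fun (ball_measure R) f"
  shows "(\<integral>\<^sup>+x. ennreal ((f x)\<^sup>2) * indicator (cball 0 R) x \<partial>lborel) = ennreal (LINT x|ball_measure R. (f x)\<^sup>2)"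
proof -
  have [measurable]: "f \<in> borel_measurable borel" using assms unfolding L2_fun_def by simp
  have "(\<integral>\<^sup>+x. ennreal ((f x)\<^sup>2) * indicator (cball 0 R) x \<partial>lborel)
      = (\<integral>\<^sup>+x. ennreal ((f x)\<^sup>2) \<partial>ball_measure R)"
    by (rule nn_integral_ball_measure[symmetric]) simp
  also have "\<dots> = ennreal (LINT x|ball_measure R. (f x)\<^sup>2)"
    using assms unfolding L2_fun_def by (intro nn_integral_eq_integral) auto
  finally show ?thesis .
qed

lemma loc_integrable_L2_fun:
  fixes f :: "'a::euclidean_space \<Rightarrow> real"
  assumes "\<And>R. L2_fun (ball_measure R) f"
  shows "loc_integrable f"
  by (rule loc_integrable_L2) (use assms L2_fun_nn_integral[OF assms] in \<open>auto simp: L2_fun_def\<close>)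

lemma L2_lim_mollify:
  fixes f :: "real^'n::finite \<Rightarrow> real"
  assumes f: "\<And>R. L2_fun (ball_measure R) f"
    and \<rho>: "\<And>n. test_function (\<rho> n)" "\<And>n. mollifier (inverse (real (Suc n))) (\<rho> n)"
  shows "L2_lim (ball_measure R) (\<lambda>n. conv f (\<rho> n)) f"
proof -
  have fb: "f \<in> borel_measurable borel" using f unfolding L2_fun_def by simp
  have c: "L2_fun (ball_measure R) (conv f (\<rho> n))" for n
    by (intro L2_fun_continuous continuous_on_conv_test_function loc_integrable_L2_fun f \<rho>)
  note d = L2_fun_diff[OF c f[of R]]
  have "(\<lambda>n. LINT x|ball_measure R. (conv f (\<rho> n) x - f x)\<^sup>2) \<longlonglongrightarrow> 0"
  proof (rule LIMSEQ_I)
    fix e :: real assume e: "e > 0"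
    have "(\<integral>\<^sup>+x. ennreal ((f x)\<^sup>2) * indicator (cball 0 r) x \<partial>lborel) < \<infinity>" for r
      unfolding L2_fun_nn_integral[OF f] by simp
    from mollifier_L2_local[OF fb this, of "e/2" R] e obtain \<epsilon> where \<epsilon>: "\<epsilon> > 0"
      "\<And>\<rho>. mollifier \<epsilon> \<rho> \<Longrightarrow>
        (\<integral>\<^sup>+x. ennreal ((conv f \<rho> x - f x)\<^sup>2) * indicator (cball 0 R) x \<partial>lborel) \<le> ennreal (e/2)"
      by auto
    obtain N where N: "inverse (real (Suc N)) < \<epsilon>" using reals_Archimedean[OF \<epsilon>(1)] by blast
    have "norm ((LINT x|ball_measure R. (conv f (\<rho> n) x - f x)\<^sup>2) - 0) < e" if "n \<ge> N" for n
    proof -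
      have "inverse (real (Suc n)) \<le> inverse (real (Suc N))" using that by simp
      with N have "inverse (real (Suc n)) \<le> \<epsilon>" by linarith
      from \<epsilon>(2)[OF mollifier_mono[OF \<rho>(2) this]]
      have "ennreal (LINT x|ball_measure R. (conv f (\<rho> n) x - f x)\<^sup>2) \<le> ennreal (e/2)"
        unfolding L2_fun_nn_integral[OF d] .
      then have "(LINT x|ball_measure R. (conv f (\<rho> n) x - f x)\<^sup>2) \<le> e/2"
        using e by simp
      moreover have "(LINT x|ball_measure R. (conv f (\<rho> n) x - f x)\<^sup>2) \<ge> 0"
        by (intro integral_nonneg_AE) simp
      ultimately show ?thesis using e by simp
    qed
    then show "\<exists>N. \<forall>n\<ge>N. norm ((LINT x|ball_measure R. (conv f (\<rho> n) x - f x)\<^sup>2) - 0) < e" by blast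
  qed
  with c f show ?thesis unfolding L2_lim_def by blast
qed

text \<open>A weighted average of values within distance \<epsilon> of \<open>x\<close> obeys the
  bounds of those values. An a.e. bound on \<open>f\<close> thus becomes a bound on the convolution
  at every point of the ball.\<close>

lemma abs_conv_le:
  fixes f :: "'a::euclidean_space \<Rightarrow> real"
  assumes \<rho>: "mollifier \<epsilon> \<rho>" and f: "f \<in> borel_measurable borel"
    and b: "AE y in lborel. norm y \<le> R + \<epsilon> \<longrightarrow> \<bar>f y\<bar> \<le> B" and x: "norm x \<le> R"
  shows "\<bar>conv f \<rho> x\<bar> \<le> B"
proof -
  have c: "continuous_on UNIV \<rho>" and \<rho>0: "\<And>x. \<rho> x \<ge> 0" and \<rho>s: "\<And>x. norm x > \<epsilon> \<Longrightarrow> \<rho> x = 0"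
    and \<rho>1: "(LINT x|lborel. \<rho> x) = 1"
    using \<rho> unfolding mollifier_def by auto
  have [measurable]: "\<rho> \<in> borel_measurable borel" using borel_measurable_continuous_onI[OF c] .
  have [measurable]: "f \<in> borel_measurable borel" by fact
  have i: "integrable lborel (\<lambda>y. B * \<rho> (x - y))"
    by (rule conv_integrable[OF loc_integrable_const c \<rho>s])
  have ae: "AE y in lborel. norm (f y * \<rho> (x - y)) \<le> B * \<rho> (x - y)"
    using b
  proof eventually_elim
    fix y assume "norm y \<le> R + \<epsilon> \<longrightarrow> \<bar>f y\<bar> \<le> B"
    then show "norm (f y * \<rho> (x - y)) \<le> B * \<rho> (x - y)"
      using \<rho>s[of "x - y"] \<rho>0[of "x - y"] norm_triangle_ineq2[of y x] x
      by (cases "norm (x - y) > \<epsilon>") (auto simp: abs_mult norm_minus_commute intro!: mult_right_mono)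
  qed
  have int: "integrable lborel (\<lambda>y. f y * \<rho> (x - y))"
  proof (rule Bochner_Integration.integrable_bound[OF i])
    show "AE y in lborel. norm (f y * \<rho> (x - y)) \<le> norm (B * \<rho> (x - y))"
      using ae by eventually_elim (rule order_trans, assumption, simp)
  qed simp
  have "\<bar>conv f \<rho> x\<bar> \<le> (LINT y|lborel. \<bar>f y * \<rho> (x - y)\<bar>)"
    unfolding conv_def by (rule integral_abs_bound)
  also have "\<dots> \<le> (LINT y|lborel. B * \<rho> (x - y))"
    by (rule integral_mono_AE[OF integrable_abs[OF int] i]) (use ae in simp)
  also have "\<dots> = B" using integral_lborel_reflect[of \<rho> x] \<rho>1 by simp
  finally show ?thesis .
qed

text \<open>The gradient is bounded on the compact ball, and convexity of the ball allows the mean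
  value inequality. Squares and coordinates appear because \<open>L2_lim_dominated\<close> expects
  the bound in that form.\<close>

lemma C_1_lipschitz_on_ball:
  fixes f :: "real^'n::finite \<Rightarrow> real"
  assumes "C_k 1 f"
  obtains L where "\<And>p q. norm p \<le> C \<Longrightarrow> norm q \<le> C \<Longrightarrow> (f p - f q)\<^sup>2 \<le> L * (\<Sum>l\<in>UNIV. (p $ l - q $ l)\<^sup>2)"
proof -
  have d: "f differentiable (at p)" and cp: "continuous_on UNIV (partial_deriv j f)" for p j
    using assms unfolding One_nat_def by simp_all
  have "continuous_on UNIV (gradient f)"
    unfolding gradient_def by (intro continuous_on_vec_lambda cp)
  then have "compact (gradient f ` cball 0 C)"
    by (intro compact_continuous_image) (auto intro: continuous_on_subset)
  then obtain B where B: "\<forall>p\<in>cball 0 C. norm (gradient f p) \<le> B"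
    by (auto dest!: compact_imp_bounded simp: bounded_iff)
  have "(f p - f q)\<^sup>2 \<le> B\<^sup>2 * (\<Sum>l\<in>UNIV. (p $ l - q $ l)\<^sup>2)" if "norm p \<le> C" "norm q \<le> C" for p q
  proof -
    have "norm (f p - f q) \<le> B * norm (p - q)"
    proof (rule differentiable_bound[of "cball 0 C"])
      show "(f has_derivative (\<lambda>h. gradient f p \<bullet> h)) (at p within cball 0 C)" for p
        using has_derivative_gradient[OF d] has_derivative_at_withinI by blast
      show "onorm (\<lambda>h. gradient f p \<bullet> h) \<le> B" if "p \<in> cball 0 C" for p
      proof (rule onorm_le)
        fix h
        have "norm (gradient f p \<bullet> h) \<le> norm (gradient f p) * norm h"
          using Cauchy_Schwarz_ineq2 by simp
        also have "\<dots> \<le> B * norm h" using B that by (intro mult_right_mono) auto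
        finally show "norm (gradient f p \<bullet> h) \<le> B * norm h" .
      qed
    qed (use that in auto)
    from power_mono[OF this norm_ge_zero, of 2]
    have "(f p - f q)\<^sup>2 \<le> B\<^sup>2 * (norm (p - q))\<^sup>2" by (simp add: power_mult_distrib)
    also have "(norm (p - q))\<^sup>2 = (\<Sum>l\<in>UNIV. (p $ l - q $ l)\<^sup>2)"
      unfolding power2_norm_eq_inner by (simp add: inner_vec_def power2_eq_square)
    finally show ?thesis .
  qed
  then show ?thesis by (rule that)
qed

section \<open>Passage to the limit\<close>

lemma borel_measurable_vec_lambda:
  fixes f :: "'n::finite \<Rightarrow> 'a \<Rightarrow> 'b::euclidean_space"
  assumes "\<And>l. f l \<in> borel_measurable M"
  shows "(\<lambda>x. \<chi> l. f l x) \<in> borel_measurable M"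
proof (subst borel_measurable_euclidean_space, rule ballI)
  fix b :: "'b^'n" assume "b \<in> Basis"
  then obtain l c where b: "b = axis l c" "c \<in> Basis" by (auto simp: Basis_vec_def)
  have "(\<lambda>x. f l x \<bullet> c) \<in> borel_measurable M" using assms[of l] by simp
  then show "(\<lambda>x. (\<chi> l. f l x) \<bullet> b) \<in> borel_measurable M" by (simp add: b inner_axis)
qed

lemma L2_fun_comp_bounded:
  fixes h :: "real^'n::finite \<Rightarrow> real" and U :: "'n \<Rightarrow> 'a::euclidean_space \<Rightarrow> real"
  assumes h: "continuous_on UNIV h" and U: "\<And>l. U l \<in> borel_measurable borel"
    and b: "AE x in ball_measure R. norm (\<chi> l. U l x) \<le> C"
  shows "L2_fun (ball_measure R) (\<lambda>x. h (\<chi> l. U l x))"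
proof -
  have "compact (h ` cball 0 C)"
    using h by (intro compact_continuous_image) (auto intro: continuous_on_subset)
  then obtain B where B: "\<forall>p\<in>cball 0 C. \<bar>h p\<bar> \<le> B"
    by (auto dest!: compact_imp_bounded simp: bounded_iff)
  show ?thesis
  proof (rule L2_fun_bounded)
    from measurable_compose[OF borel_measurable_vec_lambda[OF U] borel_measurable_continuous_onI[OF h]]
    show "(\<lambda>x. h (\<chi> l. U l x)) \<in> borel_measurable borel" .
    show "AE x in ball_measure R. \<bar>h (\<chi> l. U l x)\<bar> \<le> B"
      using b by eventually_elim (use B in simp)
  qed
qed

lemma norm_vec_lambda_le:
  fixes a :: "'n::finite \<Rightarrow> real"
  assumes "\<And>l. \<bar>a l\<bar> \<le> B"
  shows "norm (\<chi> l. a l) \<le> real CARD('n) * B"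
proof -
  have "norm (\<chi> l. a l) \<le> (\<Sum>l\<in>UNIV. \<bar>a l\<bar>)" using norm_le_l1_cart[of "\<chi> l. a l"] by simp
  also have "\<dots> \<le> (\<Sum>l\<in>(UNIV::'n set). B)" by (intro sum_mono assms)
  finally show ?thesis by simp
qed

lemma integrable_stress_energy:
  fixes U :: "'n::finite \<Rightarrow> real^'n \<Rightarrow> real" and DU :: "'n \<Rightarrow> 'n \<Rightarrow> real^'n \<Rightarrow> real"
  assumes DU: "\<And>l j. L2_fun (ball_measure R) (DU l j)"
    and W: "L2_fun (ball_measure R) (\<lambda>x. W (\<chi> l. U l x))"
  shows "integrable (ball_measure R) (\<lambda>x. stress_energy W (\<chi> l. U l x) (\<chi> l j. DU l j x) $ i $ j)"
proof -
  have 1: "L2_fun (ball_measure R) (\<lambda>x::real^'n. 1)" by (rule L2_fun_continuous) simp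
  have iW: "integrable (ball_measure R) (\<lambda>x. W (\<chi> l. U l x))" using L2_fun_mult[OF W 1] by simp
  have iG: "integrable (ball_measure R) (\<lambda>x. \<Sum>l\<in>UNIV. DU l i x * DU l j x)" for i j
    by (intro Bochner_Integration.integrable_sum L2_fun_mult DU)
  have "integrable (ball_measure R) (\<lambda>x. 1/2 * (\<Sum>k\<in>UNIV. \<Sum>l\<in>UNIV. DU l k x * DU l k x) + W (\<chi> l. U l x))"
    by (intro Bochner_Integration.integrable_add integrable_mult_right Bochner_Integration.integrable_sum iG iW)
  from Bochner_Integration.integrable_diff[OF iG this] iG show ?thesis
    unfolding stress_energy_nth by (cases "i = j") simp_all
qed

lemma weak_solution_imp_stress_energy_divergence_free:
  fixes U :: "'n::finite \<Rightarrow> real^'n \<Rightarrow> real" and DU :: "'n \<Rightarrow> 'n \<Rightarrow> real^'n \<Rightarrow> real"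
  assumes W: "C_k 2 W"
    and U: "\<And>l R. L2_fun (ball_measure R) (U l)" and DU: "\<And>l j R. L2_fun (ball_measure R) (DU l j)"
    and bdd: "\<And>R. \<exists>B. \<forall>l. AE x in ball_measure R. \<bar>U l x\<bar> \<le> B"
    and grad: "\<And>\<phi> l j. test_function \<phi> \<Longrightarrow>
      (LINT x|lborel. U l x * partial_deriv j \<phi> x) = - (LINT x|lborel. DU l j x * \<phi> x)"
    and eq: "\<And>\<phi> l. test_function \<phi> \<Longrightarrow>
      (LINT x|lborel. (\<Sum>j\<in>UNIV. DU l j x * partial_deriv j \<phi> x))
        = - (LINT x|lborel. gradient W (\<chi> l. U l x) $ l * \<phi> x)"
    and \<phi>: "test_function \<phi>"
  shows "(LINT x|lborel. (\<Sum>j\<in>UNIV. stress_energy W (\<chi> l. U l x) (\<chi> l j. DU l j x) $ i $ j * partial_deriv j \<phi> x)) = 0"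
proof (cases "\<forall>x. \<phi> x = 0")
  \<comment> \<open>The mollifiers below are made out of \<phi>, so \<phi> = 0 has to be treated on
    its own.\<close>
  case True
  then have \<phi>0: "\<phi> = (\<lambda>x. 0)" by blast
  have "partial_deriv j \<phi> = (\<lambda>x. 0)" for j unfolding \<phi>0 by (simp add: partial_deriv_def fun_eq_iff)
  then show ?thesis by simp
next
  case False
  then obtain x0 where "\<phi> x0 \<noteq> 0" by blast
  have "\<exists>\<rho>::real^'n \<Rightarrow> real. test_function \<rho> \<and> mollifier (inverse (real (Suc n))) \<rho>" for n
    by (rule smooth_mollifier_exists[OF \<phi> \<open>\<phi> x0 \<noteq> 0\<close>, of "inverse (real (Suc n))"]) auto
  then obtain \<rho> :: "nat \<Rightarrow> real^'n \<Rightarrow> real" where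
    \<rho>: "\<And>n. test_function (\<rho> n)" "\<And>n. mollifier (inverse (real (Suc n))) (\<rho> n)"
    by metis
  obtain R where R: "continuous_on UNIV \<phi>" "\<And>x. norm x > R \<Longrightarrow> \<phi> x = 0"
    using \<phi> by (rule test_functionE) blast
  have R': "partial_deriv j \<phi> x = 0" if "norm x > R" for j x
    using has_pderiv_eq_0[OF has_pderiv_test_function[OF \<phi>] R(2) that] .
  have c': "continuous_on UNIV (partial_deriv j \<phi>)" for j
    using test_function_partial_deriv[OF \<phi>, of j] by (rule test_functionE)
  let ?M = "ball_measure R :: (real^'n) measure"
  define v where "v n x = (\<chi> l. conv (U l) (\<rho> n) x)" for n x
  define P where "P n x = (\<chi> l j. conv (DU l j) (\<rho> n) x)" for n x
  define u where "u x = (\<chi> l. U l x)" for x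
  define G where "G x = (\<chi> l j. DU l j x)" for x
  have Ub: "U l \<in> borel_measurable borel" for l using U unfolding L2_fun_def by simp
  have W1: "C_k 1 W" "C_k 1 (\<lambda>p. gradient W p $ l)" for l
    using W C_k_Suc_imp[of 1 W] unfolding numeral_2_eq_2 One_nat_def gradient_def by simp_all
  \<comment> \<open>The kernels have radius at most 1, so values of \<open>U\<close> up to radius
    \<open>R + 1\<close> control the convolutions on the ball of radius \<open>R\<close> that
    contains the support of \<phi>.\<close>
  obtain B where B: "\<And>l. AE x in ball_measure (R + 1). \<bar>U l x\<bar> \<le> B"
    using bdd by blast
  define C where "C = real CARD('n) * B"
  have uC: "AE x in ?M. norm (u x) \<le> C"
  proof -
    have "AE x in ball_measure (R + 1). \<forall>l\<in>UNIV. \<bar>U l x\<bar> \<le> B"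
      using B by (intro AE_finite_allI) auto
    then have "AE x in ?M. \<forall>l\<in>UNIV. \<bar>U l x\<bar> \<le> B"
      unfolding AE_ball_measure by eventually_elim simp
    then show ?thesis
      by eventually_elim (simp add: u_def C_def norm_vec_lambda_le)
  qed
  have vC: "norm (v n x) \<le> C" if "norm x \<le> R" for n x
  proof -
    have "\<bar>conv (U l) (\<rho> n) x\<bar> \<le> B" for l
    proof (rule abs_conv_le[OF mollifier_mono[OF \<rho>(2)] Ub _ that])
      show "inverse (real (Suc n)) \<le> 1" by (simp add: inverse_eq_divide)
      show "AE y in lborel. norm y \<le> R + 1 \<longrightarrow> \<bar>U l y\<bar> \<le> B" using B[of l] unfolding AE_ball_measure .
    qed
    then show ?thesis unfolding v_def C_def by (rule norm_vec_lambda_le)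
  qed
  have lv: "L2_lim ?M (\<lambda>n. conv (U l) (\<rho> n)) (U l)" for l
    by (rule L2_lim_mollify[OF U \<rho>])
  have lP: "L2_lim ?M (\<lambda>n x. P n x $ l $ j) (\<lambda>x. G x $ l $ j)" for l j
    using L2_lim_mollify[OF DU \<rho>] by (simp add: P_def G_def)
  \<comment> \<open>The bound \<open>C\<close> holds for \<open>u\<close> and for every
    \<open>v n\<close>, so a single Lipschitz constant of \<open>h\<close> on the ball of radius
    \<open>C\<close> works for all \<open>n\<close>. This is used with \<open>W\<close> and with the
    components of its gradient.\<close>
  have lh: "L2_lim ?M (\<lambda>n x. h (v n x)) (\<lambda>x. h (u x))" if h: "C_k 1 h" for h
  proof -
    obtain L where L: "\<And>p q. norm p \<le> C \<Longrightarrow> norm q \<le> C \<Longrightarrow> (h p - h q)\<^sup>2 \<le> L * (\<Sum>l\<in>UNIV. (p $ l - q $ l)\<^sup>2)"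
      using C_1_lipschitz_on_ball[OF h, of C] by blast
    show ?thesis
    proof (rule L2_lim_dominated[OF lv])
      have "continuous_on UNIV (v n)" for n
        unfolding v_def
        by (intro continuous_on_vec_lambda continuous_on_conv_test_function loc_integrable_L2_fun U \<rho>)
      then have "continuous_on UNIV (\<lambda>x. h (v n x))" for n
        by (intro continuous_on_compose2[OF C_k_continuous[OF h]]) simp_all
      then show "(\<lambda>x. h (v n x)) \<in> borel_measurable ?M" for n
        by (simp add: borel_measurable_continuous_onI)
      show "L2_fun ?M (\<lambda>x. h (u x))"
        unfolding u_def by (rule L2_fun_comp_bounded[OF C_k_continuous[OF h] Ub]) (use uC in \<open>simp add: u_def\<close>)
      show "AE x in ?M. (h (v n x) - h (u x))\<^sup>2 \<le> L * (\<Sum>l\<in>UNIV. (conv (U l) (\<rho> n) x - U l x)\<^sup>2)" for n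
        using uC unfolding AE_ball_measure
      proof eventually_elim
        fix x assume "norm x \<le> R \<longrightarrow> norm (u x) \<le> C"
        then show "norm x \<le> R \<longrightarrow> (h (v n x) - h (u x))\<^sup>2 \<le> L * (\<Sum>l\<in>UNIV. (conv (U l) (\<rho> n) x - U l x)\<^sup>2)"
          using L[OF vC, of x "u x" n] by (simp add: v_def u_def)
      qed
    qed
  qed
  \<comment> \<open>Square integrability is needed on all balls, not only on the one of radius
    \<open>R\<close>, because \<open>L2_lim_mollify\<close> asks for it in order to make the
    convolution well behaved.\<close>
  have gL2: "L2_fun (ball_measure r) (\<lambda>x. gradient W (u x) $ l)" for l r
  proof -
    obtain B where "\<And>l. AE x in ball_measure r. \<bar>U l x\<bar> \<le> B" using bdd by blast
    then have "AE x in ball_measure r. \<forall>l\<in>UNIV. \<bar>U l x\<bar> \<le> B" by (intro AE_finite_allI) auto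
    then have "AE x in ball_measure r. norm (\<chi> l. U l x) \<le> real CARD('n) * B"
      by eventually_elim (simp add: norm_vec_lambda_le)
    from L2_fun_comp_bounded[OF C_k_continuous[OF W1(2)] Ub this] show ?thesis unfolding u_def .
  qed
  have lF: "L2_lim ?M (\<lambda>n. conv (\<lambda>x. gradient W (u x) $ l) (\<rho> n)) (\<lambda>x. gradient W (u x) $ l)" for l
    by (rule L2_lim_mollify[OF gL2 \<rho>])
  have 1: "L2_lim ?M (\<lambda>n x. 1) (\<lambda>x. 1)"
    by (intro L2_lim_const L2_fun_continuous) simp
  have lW: "L1_lim ?M (\<lambda>n x. W (v n x)) (\<lambda>x. W (u x))"
    using L2_lim_mult[OF lh[OF W1(1)] 1] by simp
  have lT: "L1_lim ?M (\<lambda>n x. stress_energy W (v n x) (P n x) $ i $ j) (\<lambda>x. stress_energy W (u x) (G x) $ i $ j)" for j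
  proof -
    have lG: "L1_lim ?M (\<lambda>n x. \<Sum>l\<in>UNIV. P n x $ l $ i * P n x $ l $ j) (\<lambda>x. \<Sum>l\<in>UNIV. G x $ l $ i * G x $ l $ j)" for i j
      by (intro L1_lim_sum L2_lim_mult lP)
    have "L1_lim ?M (\<lambda>n x. 1/2 * (\<Sum>k\<in>UNIV. \<Sum>l\<in>UNIV. P n x $ l $ k * P n x $ l $ k) + W (v n x))
        (\<lambda>x. 1/2 * (\<Sum>k\<in>UNIV. \<Sum>l\<in>UNIV. G x $ l $ k * G x $ l $ k) + W (u x))"
      by (intro L1_lim_add L1_lim_cmult L1_lim_sum[OF lG] lW)
    from L1_lim_diff[OF lG this] lG show ?thesis
      unfolding stress_energy_nth by (cases "i = j") simp_all
  qed
  have lhs: "L1_lim ?M (\<lambda>n x. \<Sum>j\<in>UNIV. stress_energy W (v n x) (P n x) $ i $ j * partial_deriv j \<phi> x)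
      (\<lambda>x. \<Sum>j\<in>UNIV. stress_energy W (u x) (G x) $ i $ j * partial_deriv j \<phi> x)"
  proof (rule L1_lim_sum)
    fix j
    obtain B where "\<And>x. \<bar>partial_deriv j \<phi> x\<bar> \<le> B"
      using continuous_zero_outside_bounded[OF c' R'] by blast
    then show "L1_lim ?M (\<lambda>n x. stress_energy W (v n x) (P n x) $ i $ j * partial_deriv j \<phi> x)
        (\<lambda>x. stress_energy W (u x) (G x) $ i $ j * partial_deriv j \<phi> x)"
      by (intro L1_lim_bounded_mult[OF lT]) (auto intro: borel_measurable_continuous_onI c')
  qed
  define E where "E n x = (\<Sum>l\<in>UNIV. P n x $ l $ i *
      (conv (\<lambda>x. gradient W (u x) $ l) (\<rho> n) x - gradient W (v n x) $ l)) * \<phi> x" for n x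
  \<comment> \<open>The mollified nonlinearity and the nonlinearity of the mollification have the
    same L2 limit. Multiplied by the convergent gradients, their difference therefore tends to 0 in
    L1.\<close>
  have rhs: "L1_lim ?M E (\<lambda>x. 0)"
  proof -
    obtain B where B: "\<And>x. \<bar>\<phi> x\<bar> \<le> B" using continuous_zero_outside_bounded[OF R] by blast
    have "L1_lim ?M (\<lambda>n x. (\<Sum>l\<in>UNIV. P n x $ l $ i * conv (\<lambda>x. gradient W (u x) $ l) (\<rho> n) x
          - P n x $ l $ i * gradient W (v n x) $ l) * \<phi> x)
        (\<lambda>x. (\<Sum>l\<in>UNIV. G x $ l $ i * gradient W (u x) $ l - G x $ l $ i * gradient W (u x) $ l) * \<phi> x)"
      by (rule L1_lim_bounded_mult[OF L1_lim_sum[OF L1_lim_diff[OF L2_lim_mult[OF lP lF]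
            L2_lim_mult[OF lP lh[OF W1(2)]]]] _ B])
        (simp add: borel_measurable_continuous_onI[OF R(1)])
    then show ?thesis unfolding E_def by (simp add: right_diff_distrib)
  qed
  have meas: "f \<in> borel_measurable borel" if "integrable ?M f" for f :: "real^'n \<Rightarrow> real"
    using borel_measurable_integrable[OF that] by simp
  have id: "(LINT x|?M. (\<Sum>j\<in>UNIV. stress_energy W (v n x) (P n x) $ i $ j * partial_deriv j \<phi> x))
      = - (LINT x|?M. E n x)" for n
  proof -
    have "(LINT x|lborel. (\<Sum>j\<in>UNIV. stress_energy W (v n x) (P n x) $ i $ j * partial_deriv j \<phi> x))
        = - (LINT x|lborel. E n x)"
      unfolding E_def v_def P_def u_def
      by (rule mollified_stress_energy_identity[OF W loc_integrable_L2_fun[OF U]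
          loc_integrable_L2_fun[OF DU] grad eq \<rho>(1) \<phi>])
    moreover have "(LINT x|?M. E n x) = (LINT x|lborel. E n x)"
    proof (rule integral_ball_measure[OF meas])
      show "integrable ?M (E n)" using rhs unfolding L1_lim_def by blast
      show "E n x = 0" if "norm x > R" for x unfolding E_def using R(2)[OF that] by simp
    qed
    moreover have "(LINT x|?M. (\<Sum>j\<in>UNIV. stress_energy W (v n x) (P n x) $ i $ j * partial_deriv j \<phi> x))
        = (LINT x|lborel. (\<Sum>j\<in>UNIV. stress_energy W (v n x) (P n x) $ i $ j * partial_deriv j \<phi> x))"
      using lhs R' by (intro integral_ball_measure meas) (auto simp: L1_lim_def)
    ultimately show ?thesis by simp
  qed
  have "(\<lambda>n. - (LINT x|?M. E n x)) \<longlonglongrightarrow> - (LINT x|?M. 0)"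
    by (intro tendsto_minus L1_lim_integral rhs)
  with L1_lim_integral[OF lhs]
  have "(LINT x|?M. (\<Sum>j\<in>UNIV. stress_energy W (u x) (G x) $ i $ j * partial_deriv j \<phi> x)) = - (LINT x|?M. 0)"
    unfolding id by (rule LIMSEQ_unique)
  moreover have "(LINT x|?M. (\<Sum>j\<in>UNIV. stress_energy W (u x) (G x) $ i $ j * partial_deriv j \<phi> x))
      = (LINT x|lborel. (\<Sum>j\<in>UNIV. stress_energy W (u x) (G x) $ i $ j * partial_deriv j \<phi> x))"
    using lhs R' by (intro integral_ball_measure meas) (auto simp: L1_lim_def)
  ultimately show ?thesis unfolding u_def G_def by simp
qed

section \<open>Borel representatives\<close>

text \<open>Convolutions are developed for Borel functions, while the local spaces only provide
  Lebesgue measurable ones; altering components on null sets leaves all the tested integrals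
  unchanged.\<close>

lemma borel_representative:
  fixes f :: "'a::euclidean_space \<Rightarrow> real"
  assumes "f \<in> borel_measurable lebesgue"
  obtains g where "g \<in> borel_measurable borel" "AE x in lborel. f x = g x"
  using completion_ex_borel_measurable_real[OF assms] by (auto simp: measurable_lborel1)

lemma integral_lebesgue_eq_lborel:
  fixes f g :: "'a::euclidean_space \<Rightarrow> real"
  assumes f: "f \<in> borel_measurable lebesgue" and g: "g \<in> borel_measurable borel"
    and ae: "AE x in lborel. f x = g x"
  shows "(LINT x|lebesgue. f x) = (LINT x|lborel. g x)"
proof -
  have gl: "g \<in> borel_measurable lborel" using g by simp
  have "(LINT x|lebesgue. f x) = (LINT x|lebesgue. g x)"
    by (rule integral_cong_AE[OF f measurable_completion[OF gl] AE_completion[OF ae]])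
  also have "\<dots> = (LINT x|lborel. g x)" by (rule integral_completion[OF gl])
  finally show ?thesis .
qed

text \<open>The domination by a norm lets the same argument treat components of the vector
  \<open>u\<close> and of the matrix \<open>Du\<close>.\<close>

lemma L2_fun_representative:
  fixes f :: "real^'n::finite \<Rightarrow> 'b::euclidean_space"
  assumes f: "L2_loc f" and g: "g \<in> borel_measurable borel"
    and le: "AE x in lborel. \<bar>g x\<bar> \<le> norm (f x)"
  shows "L2_fun (ball_measure R) g"
proof -
  have [measurable]: "g \<in> borel_measurable borel" by fact
  have "integrable lebesgue (\<lambda>x. indicat_real (cball 0 R) x *\<^sub>R (norm (f x))\<^sup>2)"
    using f unfolding L2_loc_def set_integrable_def by auto
  then have "integrable lebesgue (\<lambda>x. indicat_real (cball 0 R) x *\<^sub>R (g x)\<^sup>2)"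
  proof (rule Bochner_Integration.integrable_bound)
    show "(\<lambda>x. indicat_real (cball 0 R) x *\<^sub>R (g x)\<^sup>2) \<in> borel_measurable lebesgue"
      by (rule measurable_completion) simp
    show "AE x in lebesgue. norm (indicat_real (cball 0 R) x *\<^sub>R (g x)\<^sup>2)
        \<le> norm (indicat_real (cball 0 R) x *\<^sub>R (norm (f x))\<^sup>2)"
      using AE_completion[OF le]
    proof eventually_elim
      fix x assume "\<bar>g x\<bar> \<le> norm (f x)"
      from power_mono[OF this abs_ge_zero, of 2]
      show "norm (indicat_real (cball 0 R) x *\<^sub>R (g x)\<^sup>2) \<le> norm (indicat_real (cball 0 R) x *\<^sub>R (norm (f x))\<^sup>2)"
        by (simp add: indicator_def)
    qed
  qed
  then have "integrable lborel (\<lambda>x. indicat_real (cball 0 R) x *\<^sub>R (g x)\<^sup>2)"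
    by (subst (asm) integrable_completion) simp_all
  then show ?thesis
    unfolding L2_fun_def by (simp add: integrable_ball_measure set_integrable_def)
qed

lemma stress_energy_weak_divergence_free:
  fixes W :: "real^'n::finite \<Rightarrow> real"
  assumes W: "C_k 2 W" and uDu: "W12_loc u Du" and ub: "Linf_loc u" and sol: "weak_solution W u Du"
  shows "weak_row_div (\<lambda>x. stress_energy W (u x) (Du x)) (\<lambda>x. 0)"
proof -
  let ?S = "\<lambda>x. stress_energy W (u x) (Du x)"
  have L2: "L2_loc u" "L2_loc Du" and wg: "weak_gradient u Du"
    using uDu unfolding W12_loc_def by auto
  have um: "u \<in> borel_measurable lebesgue" and Dm: "Du \<in> borel_measurable lebesgue"
    using L2 unfolding L2_loc_def by auto
  have ucm: "(\<lambda>x. u x $ l) \<in> borel_measurable lebesgue" for l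
    using measurable_compose[OF um, of "\<lambda>v. v $ l"]
    by (simp add: borel_measurable_continuous_onI continuous_on_component)
  have Dcm: "(\<lambda>x. Du x $ l $ j) \<in> borel_measurable lebesgue" for l j
    using measurable_compose[OF Dm, of "\<lambda>v. v $ l $ j"]
    by (simp add: borel_measurable_continuous_onI continuous_on_component)
  have "\<exists>g. g \<in> borel_measurable borel \<and> (AE x in lborel. u x $ l = g x)" for l
    by (rule borel_representative[OF ucm[of l]]) blast
  then obtain U where U: "\<And>l. U l \<in> borel_measurable borel" "\<And>l. AE x in lborel. u x $ l = U l x"
    by metis
  have "\<exists>g. g \<in> borel_measurable borel \<and> (AE x in lborel. Du x $ l $ j = g x)" for l j
    by (rule borel_representative[OF Dcm[of l j]]) blast
  then obtain DU where DU: "\<And>l j. DU l j \<in> borel_measurable borel"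
    "\<And>l j. AE x in lborel. Du x $ l $ j = DU l j x"
    by metis
  have aeu: "AE x in lborel. u x = (\<chi> l. U l x)"
  proof -
    have "AE x in lborel. \<forall>l\<in>UNIV. u x $ l = U l x" by (intro AE_finite_allI U) simp
    then show ?thesis by eventually_elim (simp add: vec_eq_iff)
  qed
  have aeD: "AE x in lborel. Du x = (\<chi> l j. DU l j x)"
  proof -
    have "AE x in lborel. \<forall>l\<in>UNIV. \<forall>j\<in>UNIV. Du x $ l $ j = DU l j x"
      by (intro AE_finite_allI DU) simp_all
    then show ?thesis by eventually_elim (simp add: vec_eq_iff)
  qed
  have UL2: "L2_fun (ball_measure R) (U l)" for l R
  proof (rule L2_fun_representative[OF L2(1) U(1)])
    show "AE x in lborel. \<bar>U l x\<bar> \<le> norm (u x)"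
      using U(2)[of l]
    proof eventually_elim
      fix x assume "u x $ l = U l x"
      then show "\<bar>U l x\<bar> \<le> norm (u x)" using component_le_norm_cart[of "u x" l] by simp
    qed
  qed
  have DL2: "L2_fun (ball_measure R) (DU l j)" for l j R
  proof (rule L2_fun_representative[OF L2(2) DU(1)])
    show "AE x in lborel. \<bar>DU l j x\<bar> \<le> norm (Du x)"
      using DU(2)[of l j]
    proof eventually_elim
      fix x assume "Du x $ l $ j = DU l j x"
      then have "\<bar>DU l j x\<bar> \<le> norm (Du x $ l)" using component_le_norm_cart[of "Du x $ l" j] by simp
      also have "\<dots> \<le> norm (Du x)" by (rule Finite_Cartesian_Product.norm_nth_le)
      finally show "\<bar>DU l j x\<bar> \<le> norm (Du x)" .
    qed
  qed
  have bdd: "\<exists>B. \<forall>l. AE x in ball_measure R. \<bar>U l x\<bar> \<le> B" for R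
  proof -
    obtain B where "AE x in lebesgue. x \<in> cball 0 R \<longrightarrow> norm (u x) \<le> B"
      using ub unfolding Linf_loc_def by (meson compact_cball)
    then have "AE x in lborel. x \<in> cball 0 R \<longrightarrow> norm (u x) \<le> B" by (simp add: AE_completion_iff)
    then have "AE x in lborel. norm x \<le> R \<longrightarrow> \<bar>U l x\<bar> \<le> B" for l
      using aeu
    proof eventually_elim
      fix x assume "x \<in> cball 0 R \<longrightarrow> norm (u x) \<le> B" "u x = (\<chi> l. U l x)"
      then show "norm x \<le> R \<longrightarrow> \<bar>U l x\<bar> \<le> B"
        using component_le_norm_cart[of "u x" l] by auto
    qed
    then show ?thesis unfolding AE_ball_measure by blast
  qed
  have tm: "\<phi> \<in> borel_measurable borel" "partial_deriv j \<phi> \<in> borel_measurable borel"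
    "\<phi> \<in> borel_measurable lebesgue" "partial_deriv j \<phi> \<in> borel_measurable lebesgue"
    if "test_function \<phi>" for \<phi> :: "real^'n \<Rightarrow> real" and j
  proof -
    have c: "\<psi> \<in> borel_measurable borel" if "test_function \<psi>" for \<psi> :: "real^'n \<Rightarrow> real"
      using that by (rule test_functionE) (rule borel_measurable_continuous_onI)
    show "\<phi> \<in> borel_measurable borel" "partial_deriv j \<phi> \<in> borel_measurable borel"
      using c that test_function_partial_deriv by blast+
    then show "\<phi> \<in> borel_measurable lebesgue" "partial_deriv j \<phi> \<in> borel_measurable lebesgue"
      by (simp_all add: measurable_completion)
  qed
  have grad: "(LINT x|lborel. U l x * partial_deriv j \<phi> x) = - (LINT x|lborel. DU l j x * \<phi> x)"
    if \<phi>: "test_function \<phi>" for \<phi> l j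
  proof -
    have "(LINT x|lborel. U l x * partial_deriv j \<phi> x) = (LINT x|lebesgue. u x $ l * partial_deriv j \<phi> x)"
    proof (rule integral_lebesgue_eq_lborel[symmetric])
      show "AE x in lborel. u x $ l * partial_deriv j \<phi> x = U l x * partial_deriv j \<phi> x"
        using U(2)[of l] by eventually_elim simp
    qed (intro borel_measurable_times ucm tm[OF \<phi>] U(1))+
    also have "\<dots> = - (LINT x|lebesgue. Du x $ l $ j * \<phi> x)"
      using wg \<phi> unfolding weak_gradient_def by blast
    also have "(LINT x|lebesgue. Du x $ l $ j * \<phi> x) = (LINT x|lborel. DU l j x * \<phi> x)"
    proof (rule integral_lebesgue_eq_lborel)
      show "AE x in lborel. Du x $ l $ j * \<phi> x = DU l j x * \<phi> x"
        using DU(2)[of l j] by eventually_elim simp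
    qed (intro borel_measurable_times Dcm tm[OF \<phi>] DU(1))+
    finally show ?thesis .
  qed
  have gWb: "(\<lambda>x. gradient W (\<chi> l. U l x) $ l) \<in> borel_measurable borel" for l
    by (rule measurable_compose[OF borel_measurable_vec_lambda[OF U(1)] borel_measurable_continuous_onI])
      (intro continuous_on_component continuous_on_gradient[OF W])
  have gWl: "(\<lambda>x. gradient W (u x) $ l) \<in> borel_measurable lebesgue" for l
    by (rule measurable_compose[OF um borel_measurable_continuous_onI])
      (intro continuous_on_component continuous_on_gradient[OF W])
  have eq: "(LINT x|lborel. (\<Sum>j\<in>UNIV. DU l j x * partial_deriv j \<phi> x))
        = - (LINT x|lborel. gradient W (\<chi> l. U l x) $ l * \<phi> x)"
    if \<phi>: "test_function \<phi>" for \<phi> l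
  proof -
    have "(LINT x|lborel. (\<Sum>j\<in>UNIV. DU l j x * partial_deriv j \<phi> x))
        = (LINT x|lebesgue. (\<Sum>j\<in>UNIV. Du x $ l $ j * partial_deriv j \<phi> x))"
    proof (rule integral_lebesgue_eq_lborel[symmetric])
      show "AE x in lborel. (\<Sum>j\<in>UNIV. Du x $ l $ j * partial_deriv j \<phi> x)
          = (\<Sum>j\<in>UNIV. DU l j x * partial_deriv j \<phi> x)"
        using aeD by eventually_elim simp
    qed (intro borel_measurable_sum borel_measurable_times Dcm DU(1) tm[OF \<phi>])+
    also have "\<dots> = - (LINT x|lebesgue. gradient W (u x) $ l * \<phi> x)"
      using sol \<phi> unfolding weak_solution_def weak_row_div_def by blast
    also have "(LINT x|lebesgue. gradient W (u x) $ l * \<phi> x) = (LINT x|lborel. gradient W (\<chi> l. U l x) $ l * \<phi> x)"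
    proof (rule integral_lebesgue_eq_lborel)
      show "AE x in lborel. gradient W (u x) $ l * \<phi> x = gradient W (\<chi> l. U l x) $ l * \<phi> x"
        using aeu by eventually_elim simp
    qed (intro borel_measurable_times gWl gWb tm[OF \<phi>])+
    finally show ?thesis .
  qed
  let ?T = "\<lambda>i j x. stress_energy W (\<chi> l. U l x) (\<chi> l j. DU l j x) $ i $ j"
  have aeT: "AE x in lborel. \<forall>i j. ?S x $ i $ j = ?T i j x"
    using aeu aeD by eventually_elim simp
  have Wc: "continuous_on UNIV W" by (rule C_k_continuous[OF W])
  have Wl: "(\<lambda>x. W (u x)) \<in> borel_measurable lebesgue"
    by (rule measurable_compose[OF um borel_measurable_continuous_onI[OF Wc]])
  have Sm: "(\<lambda>x. ?S x $ i $ j) \<in> borel_measurable lebesgue" for i j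
  proof -
    have m: "(\<lambda>x. \<Sum>l\<in>UNIV. Du x $ l $ i * Du x $ l $ j) \<in> borel_measurable lebesgue" for i j
      by (intro borel_measurable_sum borel_measurable_times Dcm)
    have "(\<lambda>x. 1/2 * (\<Sum>k\<in>UNIV. \<Sum>l\<in>UNIV. Du x $ l $ k * Du x $ l $ k) + W (u x)) \<in> borel_measurable lebesgue"
      by (intro borel_measurable_add borel_measurable_times borel_measurable_const borel_measurable_sum Dcm Wl)
    from borel_measurable_diff[OF m this] m show ?thesis
      unfolding stress_energy_nth by (cases "i = j") simp_all
  qed
  have iT: "integrable (ball_measure R) (?T i j)" for i j R
  proof (rule integrable_stress_energy[OF DL2])
    obtain B where "\<And>l. AE x in ball_measure R. \<bar>U l x\<bar> \<le> B" using bdd by blast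
    then have "AE x in ball_measure R. \<forall>l\<in>UNIV. \<bar>U l x\<bar> \<le> B" by (intro AE_finite_allI) auto
    then have "AE x in ball_measure R. norm (\<chi> l. U l x) \<le> real CARD('n) * B"
      by eventually_elim (simp add: norm_vec_lambda_le)
    then show "L2_fun (ball_measure R) (\<lambda>x. W (\<chi> l. U l x))"
      by (rule L2_fun_comp_bounded[OF Wc U(1)])
  qed
  have Tb: "?T i j \<in> borel_measurable borel" for i j
    using borel_measurable_integrable[OF iT] by simp
  have "(\<lambda>x. \<chi> i j. ?S x $ i $ j) \<in> borel_measurable lebesgue"
    by (intro borel_measurable_vec_lambda Sm)
  then have S_meas: "?S \<in> borel_measurable lebesgue" by simp
  \<comment> \<open>A compact set lies in a ball, on which every entry is integrable; the matrix
    norm is at most the sum of the absolute values of the entries.\<close>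
  have S_int: "set_integrable lebesgue K (\<lambda>x. norm (?S x))" if K: "compact K" for K
  proof -
    obtain r where r: "K \<subseteq> cball 0 r"
      using compact_imp_bounded[OF K] unfolding bounded_iff by (auto simp: subset_iff)
    have "integrable lborel (\<lambda>x. indicat_real (cball 0 r) x *\<^sub>R ?T i j x)" for i j
      using iT[of r i j] unfolding integrable_ball_measure[OF Tb] set_integrable_def .
    then have "integrable lborel (\<lambda>x. \<Sum>i\<in>UNIV. \<Sum>j\<in>UNIV. \<bar>indicat_real (cball 0 r) x *\<^sub>R ?T i j x\<bar>)"
      by (intro Bochner_Integration.integrable_sum integrable_abs)
    then have i: "integrable lebesgue (\<lambda>x. \<Sum>i\<in>UNIV. \<Sum>j\<in>UNIV. \<bar>indicat_real (cball 0 r) x *\<^sub>R ?T i j x\<bar>)"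
      by (subst integrable_completion) (auto dest: borel_measurable_integrable)
    show ?thesis unfolding set_integrable_def
    proof (rule Bochner_Integration.integrable_bound[OF i])
      have "K \<in> sets lebesgue" using lmeasurable_compact[OF K] by (rule fmeasurableD)
      then show "(\<lambda>x. indicat_real K x *\<^sub>R norm (?S x)) \<in> borel_measurable lebesgue"
        by (intro borel_measurable_scaleR borel_measurable_indicator measurable_compose[OF S_meas borel_measurable_norm])
      show "AE x in lebesgue. norm (indicat_real K x *\<^sub>R norm (?S x))
          \<le> norm (\<Sum>i\<in>UNIV. \<Sum>j\<in>UNIV. \<bar>indicat_real (cball 0 r) x *\<^sub>R ?T i j x\<bar>)"
        using AE_completion[OF aeT]
      proof eventually_elim
        fix x assume ST: "\<forall>i j. ?S x $ i $ j = ?T i j x"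
        show "norm (indicat_real K x *\<^sub>R norm (?S x))
          \<le> norm (\<Sum>i\<in>UNIV. \<Sum>j\<in>UNIV. \<bar>indicat_real (cball 0 r) x *\<^sub>R ?T i j x\<bar>)"
        proof (cases "x \<in> K")
          case True
          then have xr: "x \<in> cball 0 r" using r by blast
          have "norm (?S x) \<le> (\<Sum>i\<in>UNIV. norm (?S x $ i))" unfolding norm_vec_def[of "?S x"] by (rule L2_set_le_sum) simp
          also have "\<dots> \<le> (\<Sum>i\<in>UNIV. \<Sum>j\<in>UNIV. \<bar>?S x $ i $ j\<bar>)" by (intro sum_mono norm_le_l1_cart)
          also have "\<dots> = (\<Sum>i\<in>UNIV. \<Sum>j\<in>UNIV. \<bar>indicat_real (cball 0 r) x *\<^sub>R ?T i j x\<bar>)"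
            using ST xr by (simp only: indicator_simps scaleR_one)
          finally show ?thesis using True by simp
        qed simp
      qed
    qed
  qed
  have div: "(LINT x|lebesgue. (\<Sum>j\<in>UNIV. ?S x $ i $ j * partial_deriv j \<phi> x)) = 0" if \<phi>: "test_function \<phi>" for \<phi> i
  proof -
    have "(LINT x|lebesgue. (\<Sum>j\<in>UNIV. ?S x $ i $ j * partial_deriv j \<phi> x))
        = (LINT x|lborel. (\<Sum>j\<in>UNIV. ?T i j x * partial_deriv j \<phi> x))"
    proof (rule integral_lebesgue_eq_lborel)
      show "AE x in lborel. (\<Sum>j\<in>UNIV. ?S x $ i $ j * partial_deriv j \<phi> x)
          = (\<Sum>j\<in>UNIV. ?T i j x * partial_deriv j \<phi> x)"
        using aeT by eventually_elim (simp only:)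
    qed (intro borel_measurable_sum borel_measurable_times Sm Tb tm[OF \<phi>])+
    also have "\<dots> = 0"
      by (rule weak_solution_imp_stress_energy_divergence_free[OF W UL2 DL2 bdd grad eq \<phi>])
    finally show ?thesis .
  qed
  have "L1_loc (\<lambda>x::real^'n. 0::real^'n)" unfolding L1_loc_def set_integrable_def by simp
  then show ?thesis
    unfolding weak_row_div_def L1_loc_def using S_meas S_int div by simp
qed

theorem mainTheorem1:
  fixes W :: "real^'n::finite \<Rightarrow> real"
  assumes "C_k 2 W"
  shows
    "(\<forall>(u :: real^'n \<Rightarrow> real^'n) (Du :: real^'n \<Rightarrow> real^'n^'n).
        W12_loc u Du \<and> Linf_loc u \<and> weak_solution W u Du
        \<longrightarrow> weak_row_div (\<lambda>x. stress_energy W (u x) (Du x)) (\<lambda>x. 0))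
     \<and>
     (\<forall>u :: real^'n \<Rightarrow> real^'n.
        smooth u
        \<and> (\<forall>x. row_div (\<lambda>y. stress_energy W (u y) (jacobian u (at y))) x = 0)
        \<and> (\<forall>x. det (jacobian u (at x)) \<noteq> 0)
        \<longrightarrow> (\<forall>x. laplacian u x - gradient W (u x) = 0))"
proof -
  have W: "W differentiable (at p)" for p
    using assms unfolding numeral_2_eq_2 by simp
  have u: "C_k 2 u" if "smooth u" for u :: "real^'n \<Rightarrow> real^'n"
    using that unfolding smooth_def by blast
  show ?thesis
    using stress_energy_weak_divergence_free[OF assms] divergence_free_imp_elliptic[OF W u] by blast
qed

end
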